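(* Let $(X,\|\cdot\|)$ be a strictly convex Banach space and let $Z:=(X\oplus_\infty c_0(\mathbb{N}),|||\cdot|||)$ be the renorming of $X\oplus_\infty c_0(\mathbb{N})$ by the norm $$|||(x,y)|||=\inf\{\lambda>0:\Phi((x,y)/\lambda)\le1\},\qquad \Phi(x,y)=\|x\|+\sum_{n=1}^\infty y_n^{2n}.$$ The following statements are true: (i) The Banach space $Z$ is strictly convex. (ii) The Banach space $Z$ is almost square. (iii) The Banach space $Z$ has the local diameter two property. If, in addition, $X$ has a shrinking 1-unconditional basis, then the following statements are true: (iv) The Banach space $Z$ has a 1-unconditional basis. (v) The Banach space $(X^{**}\oplus_\infty\ell_\infty(\mathbb{N}),|||\cdot|||)$ is the bidual of $Z$.
   Context: All spaces are real. A Banach space is strictly convex if $\frac12\|x+y\|=\|x\|=\|y\|$ implies $x=y$. The function $\Phi:X^{**}\oplus_\infty\ell_\infty(\mathbb{N})\to[0,\infty]$ is defined by $\Phi(x,y)=\|x\|+\sum_{n=1}^\infty y_n^{2n}$ for $y=(y_n)$, where $\|\cdot\|$ is the canonical norm of $X^{**}$ (extending that of $X$), and $|||(x,y)|||=\inf\{\lambda>0:\Phi((x,y)/\lambda)\le1\}$, which is an equivalent norm on $X^{**}\oplus_\infty\ell_\infty(\mathbb{N})$; its restriction to $X\oplus_\infty c_0(\mathbb{N})$ is the norm of $Z$. Here $\oplus_\infty$ is the direct sum with the maximum norm. In (v), "is the bidual" refers to the canonical identification of $(X\oplus_\infty c_0(\mathbb{N}))^{**}$ with $X^{**}\oplus_\infty\ell_\infty(\mathbb{N})$: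 the bidual norm of the norm $|||\cdot|||$ on $Z$ is the norm $|||\cdot|||$ on $X^{**}\oplus\ell_\infty(\mathbb{N})$ defined by the formula above. A Banach space $W$ is almost square if for every finite subset $x_1,\dots,x_n$ of its unit sphere $S_W$ and every $\varepsilon>0$ there is $y\in S_W$ with $\|x_i+y\|\le1+\varepsilon$ for all $i$. A slice of the closed unit ball $B_W$ is a set $\{x\in B_W:x^*(x)>1-\varepsilon\}$ with $x^*\in S_{W^*}$, $\varepsilon>0$; $W$ has the local diameter two property (LD2P) if every slice of $B_W$ has diameter two. A family $(e_\gamma)_{\gamma\in\Gamma}$ (with $\Gamma$ a non-empty, possibly uncountable set) is an unconditional basis of $W$ if for every $x\in W$ there is a unique family of reals $(a_\gamma)$ with $x=\sum_{\gamma\in\Gamma} a_\gamma e_\gamma$, in the sense that for every $\varepsilon>0$ there is a finite $F\subset\Gamma$ with $\|x-\sum_{\gamma\in G}a_\gamma e_\gamma\|<\varepsilon$ for every finite $G\supset F$. It is 1-unconditional if moreover $\|\sum_{\gamma\in F}b_\gamma e_\gamma\|\le\|\sum_{\gamma\in F}a_\gamma e_\gamma\|$ for all finite $F\subset\Gamma$ and reals with $|b_\gamma|\le|a_\gamma|$. It is shrinking if the closed linear span of the biorthogonal functionals $\{e_\gamma^*:\gamma\in\Gamma\}$ is $W^*$. *)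

theory Defs
  imports "HOL-Analysis.Analysis"
begin

section \<open>Geometry of Banach spaces\<close>

type_synonym 'a dual = "'a \<Rightarrow>\<^sub>L real"

type_synonym 'a bidual = "'a dual dual"

definition strictly_convex :: "'a::banach itself \<Rightarrow> bool" where
  "strictly_convex _ \<longleftrightarrow>
    (\<forall>x y :: 'a. norm (x + y) / 2 = norm x \<and> norm x = norm y \<longrightarrow> x = y)"

definition almost_square :: "'a::banach itself \<Rightarrow> bool" where
  "almost_square _ \<longleftrightarrow>
    (\<forall>A :: 'a set. \<forall>\<epsilon> > 0. finite A \<and> A \<subseteq> sphere 0 1 \<longrightarrow>
      (\<exists>y \<in> sphere 0 1. \<forall>x \<in> A. norm (x + y) \<le> 1 + \<epsilon>))"

definition slice :: "'a::banach dual \<Rightarrow> real \<Rightarrow> 'a set" where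
  "slice f \<epsilon> = {x \<in> cball 0 1. blinfun_apply f x > 1 - \<epsilon>}"

definition local_diameter_two :: "'a::banach itself \<Rightarrow> bool" where
  "local_diameter_two _ \<longleftrightarrow>
    (\<forall>(f :: 'a dual) \<epsilon>. norm f = 1 \<and> \<epsilon> > 0 \<longrightarrow> diameter (slice f \<epsilon>) = 2)"


section \<open>Unconditional bases\<close>

text \<open>Families are indexed by a whole type, so the index set is nonempty, of arbitrary
  cardinality. Convergence in \<^const>\<open>has_sum\<close> is along the net of finite subsets.\<close>

definition unconditional_basis :: "('g \<Rightarrow> 'a::banach) \<Rightarrow> bool" where
  "unconditional_basis e \<longleftrightarrow>
    (\<forall>x. \<exists>!a :: 'g \<Rightarrow> real. ((\<lambda>\<gamma>. a \<gamma> *\<^sub>R e \<gamma>) has_sum x) UNIV)"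

definition one_unconditional_basis :: "('g \<Rightarrow> 'a::banach) \<Rightarrow> bool" where
  "one_unconditional_basis e \<longleftrightarrow> unconditional_basis e \<and>
    (\<forall>F (a :: 'g \<Rightarrow> real) b. finite F \<and> (\<forall>\<gamma>\<in>F. \<bar>b \<gamma>\<bar> \<le> \<bar>a \<gamma>\<bar>) \<longrightarrow>
      norm (\<Sum>\<gamma>\<in>F. b \<gamma> *\<^sub>R e \<gamma>) \<le> norm (\<Sum>\<gamma>\<in>F. a \<gamma> *\<^sub>R e \<gamma>))"

text \<open>A functional is determined by its values on a basis, so for each \<open>\<gamma>\<close> at most one
  functional is biorthogonal at \<open>\<gamma>\<close>.\<close>

definition biorthogonal_functionals :: "('g \<Rightarrow> 'a::banach) \<Rightarrow> 'a dual set" where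
  "biorthogonal_functionals e =
    {f. \<exists>\<gamma>. \<forall>\<delta>. blinfun_apply f (e \<delta>) = (if \<delta> = \<gamma> then 1 else 0)}"

definition shrinking :: "('g \<Rightarrow> 'a::banach) \<Rightarrow> bool" where
  "shrinking e \<longleftrightarrow> closure (span (biorthogonal_functionals e)) = UNIV"


section \<open>The modular and its Luxemburg norm\<close>

text \<open>As \<^typ>\<open>nat\<close> is discrete, the bounded continuous functions on it are all the
  bounded sequences, with the supremum norm.\<close>

type_synonym linfty = "nat \<Rightarrow>\<^sub>C real"

text \<open>Sequences are indexed from 0 here, so that entry \<open>n\<close> is the entry with number
  \<open>n + 1\<close> in the usual indexing and carries the exponent \<open>2 (n + 1)\<close>.

  The first summand is an arbitrary normed space: it is used both for a space and for its
  bidual.\<close>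

definition modular :: "'b::real_normed_vector \<times> linfty \<Rightarrow> ennreal" where
  "modular p = ennreal (norm (fst p)) + (\<Sum>n. ennreal (apply_bcontfun (snd p) n ^ (2 * (n + 1))))"

definition lux_norm :: "'b::real_normed_vector \<times> linfty \<Rightarrow> real" where
  "lux_norm p = Inf {l. l > 0 \<and> modular (p /\<^sub>R l) \<le> 1}"

definition max_norm :: "'b::real_normed_vector \<times> linfty \<Rightarrow> real" where
  "max_norm p = max (norm (fst p)) (norm (snd p))"

lemma max_norm_nonneg: "0 \<le> max_norm p"
  by (simp add: max_norm_def le_max_iff_disj)

lemma modular_le_1D:
  assumes "modular p \<le> 1"
  shows "max_norm p \<le> 1"
proof -
  have "ennreal (norm (fst p)) \<le> modular p"
    by (simp add: modular_def)
  with assms have "ennreal (norm (fst p)) \<le> 1" by (rule order_trans[rotated])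
  then have 1: "norm (fst p) \<le> 1" by simp
  have "norm (apply_bcontfun (snd p) n) \<le> 1" for n
  proof -
    let ?t = "apply_bcontfun (snd p) n"
    have "ennreal (?t ^ (2 * (n + 1))) = sum (\<lambda>n. ennreal (apply_bcontfun (snd p) n ^ (2 * (n + 1)))) {n}"
      by simp
    also have "\<dots> \<le> (\<Sum>n. ennreal (apply_bcontfun (snd p) n ^ (2 * (n + 1))))"
      by (rule sum_le_suminf) auto
    also have "\<dots> \<le> modular p" by (simp add: modular_def)
    finally have "ennreal (?t ^ (2 * (n + 1))) \<le> 1" using assms by (rule order_trans)
    then have "?t ^ (2 * (n + 1)) \<le> 1" by simp
    then have "\<bar>?t\<bar> ^ (2 * (n + 1)) \<le> 1" by (simp add: power_even_abs)
    then show "norm ?t \<le> 1"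
      using one_less_power[of "\<bar>?t\<bar>" "2 * (n + 1)"] by (force simp: not_less[symmetric])
  qed
  then have "norm (snd p) \<le> 1" by (rule norm_bound)
  with 1 show ?thesis by (simp add: max_norm_def)
qed

lemma max_norm_scaleR: "max_norm (c *\<^sub>R p) = \<bar>c\<bar> * max_norm p"
  by (simp add: max_norm_def max_mult_distrib_left)

lemma modular_half:
  assumes "max_norm p \<le> 1/2"
  shows "modular p \<le> 1"
proof -
  have 1: "norm (fst p) \<le> 1/2" and 2: "norm (snd p) \<le> 1/2"
    using assms by (auto simp: max_norm_def)
  have le: "apply_bcontfun (snd p) n ^ (2 * (n + 1)) \<le> 1/4 * (1/4) ^ n" for n
  proof -
    have "\<bar>apply_bcontfun (snd p) n\<bar> \<le> 1/2"
      using norm_bounded[of "snd p" n] 2 by simp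
    then have "\<bar>apply_bcontfun (snd p) n\<bar> ^ (2 * (n + 1)) \<le> (1/2) ^ (2 * (n + 1))"
      by (intro power_mono) auto
    also have "(1/2::real) ^ (2 * (n + 1)) = ((1/2)^2) ^ (n + 1)"
      by (rule power_mult)
    also have "\<dots> = 1/4 * (1/4) ^ n" by (simp add: power2_eq_square)
    finally show ?thesis by (simp add: power_even_abs)
  qed
  have "(\<lambda>n. (1/4) * (1/4) ^ n :: real) sums (1/4 * (1 / (1 - 1/4)))"
    by (intro sums_mult geometric_sums) simp
  then have s: "(\<lambda>n. (1/4) * (1/4) ^ n :: real) sums (1/3)" by simp
  have "(\<Sum>n. ennreal (apply_bcontfun (snd p) n ^ (2 * (n + 1)))) \<le> (\<Sum>n. ennreal (1/4 * (1/4) ^ n))"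
    by (intro suminf_le ennreal_leI le) auto
  also have "\<dots> = ennreal (1/3)"
    using s by (intro suminf_ennreal_eq) auto
  finally have "modular p \<le> ennreal (1/2) + ennreal (1/3)"
    unfolding modular_def using 1 by (intro add_mono ennreal_leI)
  also have "\<dots> = ennreal (1/2 + 1/3)" by (subst ennreal_plus) auto
  also have "\<dots> \<le> ennreal 1" by (intro ennreal_leI) simp
  finally show ?thesis by simp
qed

lemma modular_convex:
  assumes "0 \<le> s" "0 \<le> t" "s + t = 1"
  shows "modular (s *\<^sub>R p + t *\<^sub>R q) \<le> ennreal s * modular p + ennreal t * modular q"
proof -
  let ?P = "\<lambda>n. apply_bcontfun (snd p) n" and ?Q = "\<lambda>n. apply_bcontfun (snd q) n"
  have "norm (s *\<^sub>R fst p + t *\<^sub>R fst q) \<le> s * norm (fst p) + t * norm (fst q)"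
    using norm_triangle_ineq[of "s *\<^sub>R fst p" "t *\<^sub>R fst q"] assms by simp
  then have 1: "ennreal (norm (s *\<^sub>R fst p + t *\<^sub>R fst q)) \<le>
      ennreal s * ennreal (norm (fst p)) + ennreal t * ennreal (norm (fst q))"
    using assms by (simp flip: ennreal_mult ennreal_plus add: ennreal_leI)
  have c: "(s * ?P n + t * ?Q n) ^ (2 * (n + 1)) \<le> s * ?P n ^ (2 * (n + 1)) + t * ?Q n ^ (2 * (n + 1))" for n
  proof -
    have "convex_on UNIV (\<lambda>x::real. x ^ (2 * (n + 1)))"
      by (rule convex_power_even) simp
    then show ?thesis
      using assms by (auto simp: convex_on_def simp del: power_Suc)
  qed
  have "ennreal ((s * ?P n + t * ?Q n) ^ (2 * (n + 1))) \<le>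
      ennreal s * ennreal (?P n ^ (2 * (n + 1))) + ennreal t * ennreal (?Q n ^ (2 * (n + 1)))" for n
  proof -
    have "ennreal ((s * ?P n + t * ?Q n) ^ (2 * (n + 1))) \<le>
        ennreal (s * ?P n ^ (2 * (n + 1)) + t * ?Q n ^ (2 * (n + 1)))"
      by (rule ennreal_leI[OF c])
    also have "\<dots> = ennreal s * ennreal (?P n ^ (2 * (n + 1))) + ennreal t * ennreal (?Q n ^ (2 * (n + 1)))"
      using assms zero_le_even_power[of "2 * (n + 1)"]
      by (simp add: ennreal_plus ennreal_mult del: power_Suc mult_Suc_right)
    finally show ?thesis .
  qed
  then have "(\<Sum>n. ennreal ((s * ?P n + t * ?Q n) ^ (2 * (n + 1)))) \<le>
      (\<Sum>n. ennreal s * ennreal (?P n ^ (2 * (n + 1))) + ennreal t * ennreal (?Q n ^ (2 * (n + 1))))"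
    by (intro suminf_le) auto
  also have "\<dots> = ennreal s * (\<Sum>n. ennreal (?P n ^ (2 * (n + 1)))) + ennreal t * (\<Sum>n. ennreal (?Q n ^ (2 * (n + 1))))"
    by (subst suminf_add[symmetric]) auto
  finally have 2: "(\<Sum>n. ennreal ((s * ?P n + t * ?Q n) ^ (2 * (n + 1)))) \<le> \<dots>" .
  have "modular (s *\<^sub>R p + t *\<^sub>R q) =
     ennreal (norm (s *\<^sub>R fst p + t *\<^sub>R fst q)) + (\<Sum>n. ennreal ((s * ?P n + t * ?Q n) ^ (2 * (n + 1))))"
    by (simp add: modular_def)
  also have "\<dots> \<le> ennreal s * modular p + ennreal t * modular q"
    unfolding modular_def using add_mono[OF 1 2] by (simp add: distrib_left ac_simps)
  finally show ?thesis .
qed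

lemma lux_set:
  fixes p :: "'b::real_normed_vector \<times> linfty"
  defines "S \<equiv> {l. l > 0 \<and> modular (p /\<^sub>R l) \<le> 1}"
  shows lux_mem: "\<And>l. l > 0 \<Longrightarrow> 2 * max_norm p \<le> l \<Longrightarrow> l \<in> S"
    and lux_nonempty: "S \<noteq> {}" and lux_bdd: "bdd_below S"
    and lux_ge: "\<And>l. l \<in> S \<Longrightarrow> max_norm p \<le> l"
proof -
  show mem: "l \<in> S" if "l > 0" "2 * max_norm p \<le> l" for l
    using that unfolding S_def
    by (auto intro!: modular_half simp: max_norm_scaleR field_simps)
  show "S \<noteq> {}"
    using mem[of "2 * max_norm p + 1"] max_norm_nonneg[of p] by auto
  show "bdd_below S" by (rule bdd_belowI[of _ 0]) (auto simp: S_def)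
  show "max_norm p \<le> l" if "l \<in> S" for l
    using that modular_le_1D[of "p /\<^sub>R l"] unfolding S_def
    by (auto simp: max_norm_scaleR field_simps)
qed

lemma max_norm_le_lux_norm: "max_norm p \<le> lux_norm p"
  unfolding lux_norm_def by (intro cInf_greatest lux_nonempty) (rule lux_ge)

lemma lux_norm_le_max_norm: "lux_norm p \<le> 2 * max_norm p"
proof (rule field_le_epsilon)
  fix e :: real assume "0 < e"
  then show "lux_norm p \<le> 2 * max_norm p + e"
    unfolding lux_norm_def using max_norm_nonneg[of p]
    by (intro cInf_lower lux_bdd lux_mem) auto
qed

lemma lux_norm_triangle: "lux_norm (p + q) \<le> lux_norm p + lux_norm q"
proof (rule field_le_epsilon)
  fix e :: real assume "0 < e"
  then have "lux_norm p < lux_norm p + e/2" "lux_norm q < lux_norm q + e/2" by auto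
  then obtain l m where l: "l > 0" "modular (p /\<^sub>R l) \<le> 1" "l < lux_norm p + e/2"
      and m: "m > 0" "modular (q /\<^sub>R m) \<le> 1" "m < lux_norm q + e/2"
    unfolding lux_norm_def
    using cInf_lessD[OF lux_nonempty[of p]] cInf_lessD[OF lux_nonempty[of q]] by blast
  let ?s = "l / (l + m)" and ?t = "m / (l + m)"
  have st: "0 \<le> ?s" "0 \<le> ?t" "?s + ?t = 1" using l m by (auto simp flip: add_divide_distrib)
  have eq: "(p + q) /\<^sub>R (l + m) = ?s *\<^sub>R (p /\<^sub>R l) + ?t *\<^sub>R (q /\<^sub>R m)"
    using l m by (simp add: scaleR_add_right divide_simps)
  have "modular ((p + q) /\<^sub>R (l + m)) \<le> ennreal ?s * 1 + ennreal ?t * 1"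
    unfolding eq by (rule order_trans[OF modular_convex[OF st]]) (intro add_mono mult_left_mono l m; simp)
  also have "\<dots> = ennreal (?s + ?t)" using st(1,2) by simp
  also have "\<dots> = 1" using st by simp
  finally have "lux_norm (p + q) \<le> l + m"
    unfolding lux_norm_def using l m by (intro cInf_lower lux_bdd) auto
  then show "lux_norm (p + q) \<le> lux_norm p + lux_norm q + e" using l m by linarith
qed

lemma lux_norm_scaleR:
  fixes p :: "'b::real_normed_vector \<times> linfty"
  shows "lux_norm (c *\<^sub>R p) = \<bar>c\<bar> * lux_norm p"
proof -
  have modular_minus: "modular (- p) = modular p" for p :: "'b \<times> linfty"
    by (simp add: modular_def)
  have le: "lux_norm (c *\<^sub>R p) \<le> \<bar>c\<bar> * lux_norm p" if "c \<noteq> 0" for c and p :: "'b \<times> linfty"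
  proof -
    have "lux_norm (c *\<^sub>R p) / \<bar>c\<bar> \<le> lux_norm p"
      unfolding lux_norm_def[of p]
    proof (intro cInf_greatest lux_nonempty)
      fix l assume "l \<in> {l. l > 0 \<and> modular (p /\<^sub>R l) \<le> 1}"
      then have l: "l > 0" "modular (p /\<^sub>R l) \<le> 1" by auto
      have "(c *\<^sub>R p) /\<^sub>R (\<bar>c\<bar> * l) = p /\<^sub>R l \<or> (c *\<^sub>R p) /\<^sub>R (\<bar>c\<bar> * l) = - (p /\<^sub>R l)"
        using that l by (cases "c > 0") (auto simp: field_simps)
      then have "modular ((c *\<^sub>R p) /\<^sub>R (\<bar>c\<bar> * l)) \<le> 1"
        using l modular_minus by metis
      then have "lux_norm (c *\<^sub>R p) \<le> \<bar>c\<bar> * l"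
        unfolding lux_norm_def using that l by (intro cInf_lower lux_bdd) auto
      then show "lux_norm (c *\<^sub>R p) / \<bar>c\<bar> \<le> l" using that by (simp add: field_simps)
    qed
    then show ?thesis using that by (simp add: field_simps)
  qed
  show ?thesis
  proof (cases "c = 0")
    case True
    have "max_norm (0 :: 'b \<times> linfty) = 0" by (simp add: max_norm_def)
    then have "lux_norm (0 :: 'b \<times> linfty) = 0"
      using max_norm_le_lux_norm[of "0 :: 'b \<times> linfty"] lux_norm_le_max_norm[of "0 :: 'b \<times> linfty"] by simp
    with True show ?thesis by simp
  next
    case False
    have "lux_norm (inverse c *\<^sub>R (c *\<^sub>R p)) \<le> \<bar>inverse c\<bar> * lux_norm (c *\<^sub>R p)"
      using False by (intro le) auto
    then have "\<bar>c\<bar> * lux_norm p \<le> lux_norm (c *\<^sub>R p)"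
      using False by (simp add: field_simps)
    with le[OF False, of p] show ?thesis by simp
  qed
qed

lemma lux_norm_eq_0: "lux_norm p = 0 \<longleftrightarrow> p = 0"
proof
  assume "lux_norm p = 0"
  then have "max_norm p \<le> 0" using max_norm_le_lux_norm[of p] by simp
  then show "p = 0" by (simp add: max_norm_def prod_eq_iff)
next
  assume "p = 0"
  then show "lux_norm p = 0" using lux_norm_scaleR[of 0 p] by simp
qed


section \<open>The renorming of the sum with the null sequences\<close>

text \<open>The elements are the pairs of a vector and a null sequence. Their norm is
  \<^const>\<open>lux_norm\<close>, which is equivalent to \<^const>\<open>max_norm\<close> by
  \<open>max_norm_le_lux_norm\<close> and \<open>lux_norm_le_max_norm\<close>.\<close>

typedef (overloaded) 'a zspace =
    "{p :: 'a::real_normed_vector \<times> linfty. apply_bcontfun (snd p) \<longlonglongrightarrow> 0}"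
  morphisms zpair Zspace
  by (rule exI[of _ 0]) simp

setup_lifting type_definition_zspace

instantiation zspace :: (real_normed_vector) real_vector
begin

lift_definition zero_zspace :: "'a zspace" is 0
  by simp

lift_definition plus_zspace :: "'a zspace \<Rightarrow> 'a zspace \<Rightarrow> 'a zspace" is "(+)"
  by (auto intro!: tendsto_eq_intros)

lift_definition minus_zspace :: "'a zspace \<Rightarrow> 'a zspace \<Rightarrow> 'a zspace" is "(-)"
  by (auto intro!: tendsto_eq_intros)

lift_definition uminus_zspace :: "'a zspace \<Rightarrow> 'a zspace" is uminus
  by (auto intro!: tendsto_eq_intros)

lift_definition scaleR_zspace :: "real \<Rightarrow> 'a zspace \<Rightarrow> 'a zspace" is scaleR
  by (auto intro!: tendsto_eq_intros)

instance
proof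
  fix x y z :: "'a zspace" and a b :: real
  show "(x + y) + z = x + (y + z)" by transfer (simp add: add.assoc)
  show "x + y = y + x" by transfer (simp add: add.commute)
  show "0 + x = x" by transfer simp
  show "- x + x = 0" by transfer simp
  show "x - y = x + - y" by transfer simp
  show "a *\<^sub>R (x + y) = a *\<^sub>R x + a *\<^sub>R y" by transfer (rule scaleR_add_right)
  show "(a + b) *\<^sub>R x = a *\<^sub>R x + b *\<^sub>R x" by transfer (rule scaleR_add_left)
  show "a *\<^sub>R b *\<^sub>R x = (a * b) *\<^sub>R x" by transfer simp
  show "1 *\<^sub>R x = x" by transfer simp
qed

end

instantiation zspace :: (real_normed_vector) real_normed_vector
begin

definition norm_zspace :: "'a zspace \<Rightarrow> real" where
  "norm_zspace z = lux_norm (zpair z)"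

definition dist_zspace :: "'a zspace \<Rightarrow> 'a zspace \<Rightarrow> real" where
  "dist_zspace x y = norm (x - y)"

definition sgn_zspace :: "'a zspace \<Rightarrow> 'a zspace" where
  "sgn_zspace x = x /\<^sub>R norm x"

definition uniformity_zspace :: "('a zspace \<times> 'a zspace) filter" where
  "uniformity_zspace = (INF e\<in>{0<..}. principal {(x, y). dist x y < e})"

definition open_zspace :: "'a zspace set \<Rightarrow> bool" where
  "open_zspace U \<longleftrightarrow> (\<forall>x\<in>U. eventually (\<lambda>(x', y). x' = x \<longrightarrow> y \<in> U) uniformity)"

instance
proof
  fix x y :: "'a zspace" and a :: real
  show "norm x = 0 \<longleftrightarrow> x = 0" unfolding norm_zspace_def by transfer (rule lux_norm_eq_0)
  show "norm (x + y) \<le> norm x + norm y"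
    unfolding norm_zspace_def by transfer (rule lux_norm_triangle)
  show "norm (a *\<^sub>R x) = \<bar>a\<bar> * norm x"
    unfolding norm_zspace_def by transfer (rule lux_norm_scaleR)
qed (rule dist_zspace_def sgn_zspace_def uniformity_zspace_def open_zspace_def)+

end

lemma norm_zspace_bounds:
  shows "max_norm (zpair z) \<le> norm z" and "norm z \<le> 2 * max_norm (zpair z)"
  unfolding norm_zspace_def by (rule max_norm_le_lux_norm lux_norm_le_max_norm)+

lemma bounded_linear_zpair: "bounded_linear zpair"
proof (rule bounded_linear_intro[where K = 2])
  fix x :: "'a zspace"
  have "norm (zpair x) \<le> norm (fst (zpair x)) + norm (snd (zpair x))"
    by (metis norm_Pair_le prod.collapse)
  also have "\<dots> \<le> norm x * 2"
    using norm_zspace_bounds(1)[of x] by (simp add: max_norm_def)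
  finally show "norm (zpair x) \<le> norm x * 2" .
qed (simp_all add: plus_zspace.rep_eq scaleR_zspace.rep_eq)

lemma linfty_Cauchy_convergent:
  assumes "Cauchy (f :: nat \<Rightarrow> linfty)"
  shows "\<exists>l. f \<longlonglongrightarrow> l"
proof -
  obtain g where "uniform_limit UNIV f g sequentially"
    using assms uniformly_convergent_eq_cauchy[of "\<lambda>_. True" f]
    unfolding Cauchy_def uniform_limit_sequentially_iff
    by (metis dist_fun_lt_imp_dist_val_lt)
  from uniform_limit_bcontfunE[OF this sequentially_bot] show ?thesis by metis
qed

instance zspace :: (banach) banach
proof
  fix X :: "nat \<Rightarrow> 'a zspace" assume X: "Cauchy X"
  have C: "Cauchy (\<lambda>n. zpair (X n))"
    by (rule bounded_linear.Cauchy[OF bounded_linear_zpair X])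
  have "Cauchy (\<lambda>n. fst (zpair (X n)))" "Cauchy (\<lambda>n. snd (zpair (X n)))"
    by (rule bounded_linear.Cauchy[OF bounded_linear_fst C] bounded_linear.Cauchy[OF bounded_linear_snd C])+
  then obtain x y where x: "(\<lambda>n. fst (zpair (X n))) \<longlonglongrightarrow> x"
      and y: "(\<lambda>n. snd (zpair (X n))) \<longlonglongrightarrow> y"
    by (auto dest!: Cauchy_convergent linfty_Cauchy_convergent simp: convergent_def)
  have "apply_bcontfun y \<longlonglongrightarrow> 0"
  proof (rule LIMSEQ_I)
    fix r :: real assume "0 < r"
    then obtain n where n: "dist (snd (zpair (X n))) y < r / 2"
      using metric_LIMSEQ_D[OF y, of "r / 2"] by auto
    have "apply_bcontfun (snd (zpair (X n))) \<longlonglongrightarrow> 0" using zpair[of "X n"] by simp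
    then obtain M where M: "\<And>k. k \<ge> M \<Longrightarrow> \<bar>apply_bcontfun (snd (zpair (X n))) k\<bar> < r / 2"
      using LIMSEQ_D[of _ 0 "r / 2"] \<open>0 < r\<close> by fastforce
    have "\<bar>apply_bcontfun y k\<bar> < r" if "k \<ge> M" for k
      using M[OF that] n dist_bounded[of "snd (zpair (X n))" k y] by (simp add: dist_real_def)
    then show "\<exists>M. \<forall>k\<ge>M. norm (apply_bcontfun y k - 0) < r" by auto
  qed
  then have L: "zpair (Zspace (x, y)) = (x, y)" by (simp add: Zspace_inverse)
  have "X \<longlonglongrightarrow> Zspace (x, y)"
  proof (rule metric_LIMSEQ_I)
    fix r :: real assume "0 < r"
    have "(\<lambda>n. max_norm (zpair (X n) - (x, y))) \<longlonglongrightarrow> max (norm (x - x)) (norm (y - y))"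
      unfolding max_norm_def fst_diff snd_diff fst_conv snd_conv
      by (intro tendsto_max tendsto_norm tendsto_diff x y tendsto_const)
    then have "(\<lambda>n. 2 * max_norm (zpair (X n) - (x, y))) \<longlonglongrightarrow> 0"
      by (auto intro!: tendsto_eq_intros)
    from order_tendstoD(2)[OF this \<open>0 < r\<close>]
    obtain N where N: "\<And>n. n \<ge> N \<Longrightarrow> 2 * max_norm (zpair (X n) - (x, y)) < r"
      by (auto simp: eventually_sequentially)
    have "dist (X n) (Zspace (x, y)) < r" if "n \<ge> N" for n
      using norm_zspace_bounds(2)[of "X n - Zspace (x, y)"] N[OF that]
      by (simp add: dist_norm minus_zspace.rep_eq L)
    then show "\<exists>N. \<forall>n\<ge>N. dist (X n) (Zspace (x, y)) < r" by blast
  qed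
  then show "convergent X" by (auto simp: convergent_def)
qed


section \<open>The canonical identification of the bidual\<close>

setup_lifting type_definition_bcontfun

lift_definition unit_seq :: "nat \<Rightarrow> linfty" is "\<lambda>n k. if k = n then 1 else 0"
  by (rule bcontfun_normI[where b = 1]) auto

lift_definition zinl :: "'a::real_normed_vector \<Rightarrow> 'a zspace" is "\<lambda>x. (x, 0)"
  by simp

lift_definition zunit :: "nat \<Rightarrow> 'a::real_normed_vector zspace" is "\<lambda>n. (0, unit_seq n)"
proof -
  fix n
  have "\<forall>\<^sub>F k in sequentially. apply_bcontfun (unit_seq n) k = 0"
    by (rule eventually_sequentiallyI[of "Suc n"]) (simp add: unit_seq.rep_eq)
  then show "apply_bcontfun (snd (0::'a, unit_seq n)) \<longlonglongrightarrow> 0" by (simp add: tendsto_eventually)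
qed

lemma bounded_linear_zinl: "bounded_linear zinl"
proof (rule bounded_linear_intro[where K = 2])
  fix x y :: 'a and r :: real
  show "zinl (x + y) = zinl x + zinl y" by transfer simp
  show "zinl (r *\<^sub>R x) = r *\<^sub>R zinl x" by transfer simp
  show "norm (zinl x) \<le> norm x * 2"
    using norm_zspace_bounds(2)[of "zinl x"] by (simp add: zinl.rep_eq max_norm_def)
qed

lemma zpair_sum: "zpair (\<Sum>i\<in>A. f i) = (\<Sum>i\<in>A. zpair (f i))"
  by (rule linear_sum[OF bounded_linear.linear[OF bounded_linear_zpair]])

lemma apply_bcontfun_sum: "apply_bcontfun (\<Sum>i\<in>A. f i) k = (\<Sum>i\<in>A. apply_bcontfun (f i) k)"
  by (induction A rule: infinite_finite_induct) auto

lemma zpair_sum_zunit: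
  "fst (zpair (\<Sum>n<N. c n *\<^sub>R zunit n)) = 0"
  "apply_bcontfun (snd (zpair (\<Sum>n<N. c n *\<^sub>R zunit n))) k = (if k < N then c k else 0)"
  by (auto simp: zpair_sum scaleR_zspace.rep_eq zunit.rep_eq fst_sum snd_sum apply_bcontfun_sum
      unit_seq.rep_eq if_distrib sum.delta cong: if_cong)

lemma sum_abs_zunit_le:
  fixes f :: "'a::real_normed_vector zspace dual"
  shows "(\<Sum>n<N. \<bar>blinfun_apply f (zunit n)\<bar>) \<le> 2 * norm f"
proof -
  let ?z = "\<Sum>n<N. sgn (blinfun_apply f (zunit n)) *\<^sub>R (zunit n :: 'a zspace)"
  have "norm (snd (zpair ?z)) \<le> 1"
    by (rule norm_bound) (auto simp: zpair_sum_zunit abs_sgn_eq)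
  then have "norm ?z \<le> 2"
    using norm_zspace_bounds(2)[of ?z] unfolding max_norm_def zpair_sum_zunit by simp
  have "(\<Sum>n<N. \<bar>blinfun_apply f (zunit n)\<bar>) = blinfun_apply f ?z"
    by (simp add: blinfun.sum_right blinfun.scaleR_right abs_sgn mult.commute)
  also have "\<dots> \<le> norm f * norm ?z" using norm_blinfun[of f ?z] by simp
  also have "\<dots> \<le> norm f * 2" by (intro mult_left_mono \<open>norm ?z \<le> 2\<close>) simp
  finally show ?thesis by simp
qed

lemma summable_zunit:
  shows "summable (\<lambda>n. \<bar>blinfun_apply f (zunit n)\<bar>)"
    and "(\<Sum>n. \<bar>blinfun_apply f (zunit n)\<bar>) \<le> 2 * norm f"
proof -
  show s: "summable (\<lambda>n. \<bar>blinfun_apply f (zunit n)\<bar>)"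
    by (rule summableI_nonneg_bounded[of _ "2 * norm f"]) (auto simp: sum_abs_zunit_le)
  show "(\<Sum>n. \<bar>blinfun_apply f (zunit n)\<bar>) \<le> 2 * norm f"
    by (rule suminf_le_const[OF s sum_abs_zunit_le])
qed

lemma summable_linfty_zunit:
  shows "summable (\<lambda>n. \<bar>apply_bcontfun y n * blinfun_apply f (zunit n)\<bar>)"
    and "\<bar>\<Sum>n. apply_bcontfun y n * blinfun_apply f (zunit n)\<bar> \<le> 2 * norm y * norm f"
proof -
  have le: "\<bar>apply_bcontfun y n * blinfun_apply f (zunit n)\<bar> \<le> norm y * \<bar>blinfun_apply f (zunit n)\<bar>" for n
    using norm_bounded[of y n] by (simp add: abs_mult mult_right_mono)
  have s: "summable (\<lambda>n. norm y * \<bar>blinfun_apply f (zunit n)\<bar>)"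
    by (intro summable_mult summable_zunit)
  show s': "summable (\<lambda>n. \<bar>apply_bcontfun y n * blinfun_apply f (zunit n)\<bar>)"
    by (rule summable_comparison_test'[OF s, of 0]) (use le in auto)
  have "\<bar>\<Sum>n. apply_bcontfun y n * blinfun_apply f (zunit n)\<bar> \<le>
      (\<Sum>n. \<bar>apply_bcontfun y n * blinfun_apply f (zunit n)\<bar>)"
    by (rule summable_rabs[OF s'])
  also have "\<dots> \<le> (\<Sum>n. norm y * \<bar>blinfun_apply f (zunit n)\<bar>)"
    by (rule suminf_le[OF le s' s])
  also have "\<dots> = norm y * (\<Sum>n. \<bar>blinfun_apply f (zunit n)\<bar>)"
    by (rule suminf_mult[OF summable_zunit(1)])
  also have "\<dots> \<le> norm y * (2 * norm f)"
    by (intro mult_left_mono summable_zunit) simp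
  finally show "\<bar>\<Sum>n. apply_bcontfun y n * blinfun_apply f (zunit n)\<bar> \<le> 2 * norm y * norm f"
    by (simp add: mult.commute mult.left_commute)
qed

lemmas summable_linfty_zunit' = summable_linfty_zunit(1)[THEN summable_rabs_cancel]

text \<open>A functional on \<^typ>\<open>'a zspace\<close> is a pair consisting of a functional on \<^typ>\<open>'a\<close> and the
  absolutely summable sequence of its values on the unit vectors; an element of the bidual of
  \<^typ>\<open>'a\<close> acts on the former and a bounded sequence on the latter.\<close>

lift_definition bidual_map :: "'a::real_normed_vector bidual \<times> linfty \<Rightarrow> 'a zspace bidual" is
  "\<lambda>p f. blinfun_apply (fst p) (f o\<^sub>L Blinfun zinl) +
     (\<Sum>n. apply_bcontfun (snd p) n * blinfun_apply f (zunit n))"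
proof -
  fix p :: "'a bidual \<times> linfty"
  let ?x = "fst p" and ?y = "snd p"
  show "bounded_linear (\<lambda>f. blinfun_apply ?x (f o\<^sub>L Blinfun zinl) +
     (\<Sum>n. apply_bcontfun ?y n * blinfun_apply f (zunit n)))"
  proof (rule bounded_linear_add)
    show "bounded_linear (\<lambda>f. blinfun_apply ?x (f o\<^sub>L Blinfun zinl))"
      by (rule bounded_linear_compose[OF blinfun.bounded_linear_right])
         (rule bounded_bilinear.bounded_linear_left[OF bounded_bilinear_blinfun_compose])
    show "bounded_linear (\<lambda>f :: 'a zspace dual. \<Sum>n. apply_bcontfun ?y n * blinfun_apply f (zunit n))"
    proof (rule bounded_linear_intro[where K = "2 * norm ?y"])
      fix f g :: "'a zspace dual" and r :: real
      show "(\<Sum>n. apply_bcontfun ?y n * blinfun_apply (f + g) (zunit n)) =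
          (\<Sum>n. apply_bcontfun ?y n * blinfun_apply f (zunit n)) +
          (\<Sum>n. apply_bcontfun ?y n * blinfun_apply g (zunit n))"
        by (simp add: blinfun.add_left distrib_left suminf_add summable_linfty_zunit')
      show "(\<Sum>n. apply_bcontfun ?y n * blinfun_apply (r *\<^sub>R f) (zunit n)) =
          r *\<^sub>R (\<Sum>n. apply_bcontfun ?y n * blinfun_apply f (zunit n))"
        by (simp add: blinfun.scaleR_left mult.left_commute suminf_mult summable_linfty_zunit')
      show "norm (\<Sum>n. apply_bcontfun ?y n * blinfun_apply f (zunit n)) \<le> norm f * (2 * norm ?y)"
        using summable_linfty_zunit(2)[of ?y f] by (simp add: mult.commute)
    qed
  qed
qed

lift_definition canonical_embedding :: "'a::real_normed_vector \<Rightarrow> 'a bidual" is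
  "\<lambda>x f. blinfun_apply f x"
  by (rule blinfun.bounded_linear_left)

text \<open>The identification extends the canonical embedding of the renormed space in its bidual.\<close>

lemma bidual_map_canonical_embedding:
  "bidual_map (canonical_embedding (fst (zpair z)), snd (zpair z)) = canonical_embedding z"
proof (rule blinfun_eqI)
  fix f :: "'a zspace dual"
  let ?x = "fst (zpair z)" and ?y = "snd (zpair z)"
  let ?u = "\<lambda>N. \<Sum>n<N. apply_bcontfun ?y n *\<^sub>R (zunit n :: 'a zspace)"
  have y0: "apply_bcontfun ?y \<longlonglongrightarrow> 0" using zpair[of z] by simp
  have "(\<lambda>N. zinl ?x + ?u N) \<longlonglongrightarrow> z"
  proof (rule metric_LIMSEQ_I)
    fix r :: real assume "0 < r"
    then have "0 < r / 4" by simp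
    then obtain M where M: "\<And>k. k \<ge> M \<Longrightarrow> \<bar>apply_bcontfun ?y k\<bar> < r / 4"
      using LIMSEQ_D[OF y0, of "r / 4"] by auto
    have "dist (zinl ?x + ?u N) z < r" if "N \<ge> M" for N
    proof -
      let ?d = "zinl ?x + ?u N - z"
      have 1: "fst (zpair ?d) = 0"
        by (simp add: plus_zspace.rep_eq minus_zspace.rep_eq zinl.rep_eq zpair_sum_zunit)
      have "norm (snd (zpair ?d)) \<le> r / 4"
      proof (rule norm_bound)
        fix k
        show "norm (apply_bcontfun (snd (zpair ?d)) k) \<le> r / 4"
          using M[of k] that \<open>0 < r\<close>
          by (auto simp: plus_zspace.rep_eq minus_zspace.rep_eq zinl.rep_eq zpair_sum_zunit)
      qed
      with 1 have "norm ?d \<le> 2 * (r / 4)"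
        using norm_zspace_bounds(2)[of ?d] \<open>0 < r\<close> by (simp add: max_norm_def)
      with \<open>0 < r\<close> show ?thesis by (simp add: dist_norm)
    qed
    then show "\<exists>M. \<forall>N\<ge>M. dist (zinl ?x + ?u N) z < r" by blast
  qed
  then have "(\<lambda>N. blinfun_apply f (zinl ?x + ?u N)) \<longlonglongrightarrow> blinfun_apply f z"
    by (intro tendsto_intros)
  moreover have "(\<lambda>N. blinfun_apply f (zinl ?x + ?u N)) \<longlonglongrightarrow>
      blinfun_apply f (zinl ?x) + (\<Sum>n. apply_bcontfun ?y n * blinfun_apply f (zunit n))"
    unfolding blinfun.add_right blinfun.sum_right blinfun.scaleR_right real_scaleR_def
    by (intro tendsto_add tendsto_const summable_LIMSEQ summable_linfty_zunit')
  ultimately have "blinfun_apply f z =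
      blinfun_apply f (zinl ?x) + (\<Sum>n. apply_bcontfun ?y n * blinfun_apply f (zunit n))"
    by (rule LIMSEQ_unique)
  then show "blinfun_apply (bidual_map (canonical_embedding ?x, ?y)) f = blinfun_apply (canonical_embedding z) f"
    by (simp add: bidual_map.rep_eq canonical_embedding.rep_eq
        bounded_linear_Blinfun_apply[OF bounded_linear_zinl])
qed

end

theory Submission
  imports Defs
begin


text \<open>The norm is the Luxemburg norm of a convex modular $\Phi$, whose closed unit ball is exactly
  $\{\Phi \le 1\}$ (\<open>lux_norm_le_1_iff\<close>). This follows from lower semicontinuity: $\Phi$ is the
  supremum of the partial modulars \<open>modular_upto N\<close>, each continuous along rays. So every claim
  about the norm becomes a claim about partial modulars and the scalar functions $t^{2n}$.

  Strict convexity. Let $u \ne v$ lie in the unit ball. If they differ in a coordinate of the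
  sequence part, strict convexity of $t^{2n}$ pushes $\Phi$ of the midpoint strictly below $1$;
  otherwise strict convexity of the given space does. At a point with null sequence part,
  $\Phi < 1$ forces norm $< 1$, because $\Phi$ is finite, hence continuous, along the whole ray
  through it. For general bounded sequences this fails.

  Almost squareness. Adding the unit vector with a large index $n$ to a given vector of the
  unit ball hardly changes its norm: dividing by $1 + \varepsilon$ leaves some room in $\Phi$,
  while the changed entry has absolute value at most some $q < 1$ and is raised to a power that
  grows with $n$. Almost squareness then gives the local diameter two property in every Banach
  space: if $x$ almost norms $f$ and both $\|x \pm y\|$ are close to $1$, then $f(y)$ is small,
  so that $x \pm y$, suitably scaled, lie in the slice and are almost $2$ apart.

  Basis. The norm is monotone in the norm of the first component and in the absolute values of
  the entries of the sequence, so adjoining the unit vectors to a 1-unconditional basis gives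
  a 1-unconditional basis.

  Bidual. A functional on the renormed space is the norm limit of a functional on the first
  summand plus finitely supported sequences (\<open>zspace_dual_sums\<close>), whence every element of the
  bidual is a pair. For the equality of the norms, a pair
  $(F, y)$ with $\Phi(F, y) \le 1$ acts with norm at most $1$ because, for a single functional $g$,
  the number $F(g)$ is nearly attained or exceeded by $g(x)$ for some $x$ with $\|x\| \le \|F\|$,
  and because $y$ may be truncated. Conversely, if $\Phi(F, y) > 1$, then the affine minorant of
  $\Phi$ obtained from an almost norming $g$ and the tangents of $t^{2n}$ at finitely many $y_n$
  separates $(F, y)$ from the unit ball.\<close>

section \<open>Even powers\<close>

text \<open>Strict Bernoulli inequality, rescaled. Writing $(1+x)^{2m} = (1 + (2x + x^2))^m$ makes
  Bernoulli's inequality strict, the gain being the term $m x^2$.\<close>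

lemma even_power_above_tangent:
  fixes a t :: real
  assumes "t \<noteq> a"
  shows "a ^ (2 * (n + 1)) + real (2 * (n + 1)) * a ^ (2 * n + 1) * (t - a) < t ^ (2 * (n + 1))"
proof (cases "a = 0")
  case True
  have "0 < (t ^ (n + 1))\<^sup>2"
    using True assms by (simp del: power_Suc)
  then show ?thesis
    using True by (simp add: power_even_eq del: power_Suc mult_Suc_right)
next
  case False
  define x where "x = (t - a) / a"
  have x: "x \<noteq> 0" and t: "t = a * (1 + x)"
    using False assms by (auto simp: x_def field_simps)
  have "1 + real (2 * (n + 1)) * x < 1 + real (n + 1) * (2 * x + x\<^sup>2)"
    using x by (simp add: algebra_simps add_pos_nonneg)
  also have "\<dots> \<le> (1 + (2 * x + x\<^sup>2)) ^ (n + 1)"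
    by (rule Bernoulli_inequality) (use zero_le_power2[of "x + 1"] in \<open>simp add: power2_sum\<close>)
  also have "1 + (2 * x + x\<^sup>2) = (1 + x)\<^sup>2"
    by (simp add: power2_sum)
  also have "((1 + x)\<^sup>2) ^ (n + 1) = (1 + x) ^ (2 * (n + 1))"
    by (rule power_mult[symmetric])
  finally have "1 + real (2 * (n + 1)) * x < (1 + x) ^ (2 * (n + 1))" .
  moreover have "0 < a ^ (2 * (n + 1))"
    using False by (intro zero_less_power_eq[THEN iffD2]) auto
  ultimately have "a ^ (2 * (n + 1)) * (1 + real (2 * (n + 1)) * x) < a ^ (2 * (n + 1)) * (1 + x) ^ (2 * (n + 1))"
    by (rule mult_strict_left_mono)
  also have "\<dots> = t ^ (2 * (n + 1))"
    unfolding t by (rule power_mult_distrib[symmetric])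
  also have "a ^ (2 * (n + 1)) * (1 + real (2 * (n + 1)) * x)
      = a ^ (2 * (n + 1)) + real (2 * (n + 1)) * a ^ (2 * n + 1) * (a * x)"
    by (simp add: algebra_simps)
  also have "a * x = t - a"
    using t by (simp add: algebra_simps)
  finally show ?thesis .
qed

lemma even_power_above_tangent_le:
  fixes a t :: real
  shows "a ^ (2 * (n + 1)) + real (2 * (n + 1)) * a ^ (2 * n + 1) * (t - a) \<le> t ^ (2 * (n + 1))"
  using even_power_above_tangent[of t a n] by (cases "t = a") auto

lemma even_power_midpoint_less:
  fixes a b :: real
  assumes "a \<noteq> b"
  shows "((a + b) / 2) ^ (2 * (n + 1)) < (a ^ (2 * (n + 1)) + b ^ (2 * (n + 1))) / 2"
proof -
  define m where "m = (a + b) / 2"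
  have "a \<noteq> m" "b \<noteq> m" and eq: "b - m = - (a - m)"
    using assms by (auto simp: m_def field_simps)
  from even_power_above_tangent[OF this(1), of n] even_power_above_tangent[OF this(2), of n]
  show ?thesis
    unfolding eq m_def[symmetric] by (simp add: algebra_simps del: power_Suc mult_Suc_right)
qed

lemma even_power_midpoint_le:
  fixes a b :: real
  shows "((a + b) / 2) ^ (2 * (n + 1)) \<le> (a ^ (2 * (n + 1)) + b ^ (2 * (n + 1))) / 2"
  using even_power_midpoint_less[of a b n] by (cases "a = b") auto

lemma even_power_mono_abs:
  fixes s t :: real
  assumes "\<bar>s\<bar> \<le> \<bar>t\<bar>"
  shows "s ^ (2 * (n + 1)) \<le> t ^ (2 * (n + 1))"
  using power_mono[OF assms abs_ge_zero, of "2 * (n + 1)"] by (simp add: power_even_abs)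

lemma even_power_nonneg: "0 \<le> (t::real) ^ (2 * (n + 1))"
  by (rule zero_le_even_power) simp


section \<open>The modular and its unit ball\<close>

definition modular_upto :: "nat \<Rightarrow> 'b::real_normed_vector \<times> linfty \<Rightarrow> real" where
  "modular_upto N p = norm (fst p) + (\<Sum>n<N. apply_bcontfun (snd p) n ^ (2 * (n + 1)))"

text \<open>Reduces the \<^typ>\<open>ennreal\<close>-valued modular to real partial sums. This is also the lower
  semicontinuity of the modular, which it presents as a supremum.\<close>

lemma modular_le_iff:
  assumes "0 \<le> c"
  shows "modular p \<le> ennreal c \<longleftrightarrow> (\<forall>N. modular_upto N p \<le> c)"
proof -
  let ?t = "\<lambda>n. apply_bcontfun (snd p) n ^ (2 * (n + 1))"
  have upto: "ennreal (norm (fst p)) + (\<Sum>n<N. ennreal (?t n)) = ennreal (modular_upto N p)" for N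
    unfolding modular_upto_def
    by (simp only: sum_ennreal[OF even_power_nonneg] ennreal_plus[OF norm_ge_zero sum_nonneg[OF even_power_nonneg]])
  have "modular p = (SUP N. ennreal (modular_upto N p))"
    by (simp only: modular_def suminf_eq_SUP upto[symmetric] ennreal_SUP_add_right[OF UNIV_not_empty])
  then show ?thesis
    by (simp add: SUP_le_iff ennreal_le_iff assms)
qed

lemma modular_le_1_iff: "modular p \<le> 1 \<longleftrightarrow> (\<forall>N. modular_upto N p \<le> 1)"
  using modular_le_iff[of 1 p] by simp

lemma modular_upto_mono:
  assumes "norm (fst p) \<le> norm (fst q)"
    and "\<And>n. \<bar>apply_bcontfun (snd p) n\<bar> \<le> \<bar>apply_bcontfun (snd q) n\<bar>"
  shows "modular_upto N p \<le> modular_upto N q"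
  unfolding modular_upto_def by (intro add_mono sum_mono even_power_mono_abs assms)

lemma modular_upto_mono_N:
  assumes "M \<le> N"
  shows "modular_upto M p \<le> modular_upto N p"
  unfolding modular_upto_def using assms by (intro add_left_mono sum_mono2 even_power_nonneg) auto

text \<open>The two points may live over different spaces. This compares an element of the renormed space
  with an element of the sum of the bidual and the bounded sequences.\<close>

lemma lux_norm_mono:
  fixes p :: "'b::real_normed_vector \<times> linfty" and q :: "'c::real_normed_vector \<times> linfty"
  assumes "norm (fst p) \<le> norm (fst q)"
    and "\<And>n. \<bar>apply_bcontfun (snd p) n\<bar> \<le> \<bar>apply_bcontfun (snd q) n\<bar>"
  shows "lux_norm p \<le> lux_norm q"
  unfolding lux_norm_def
proof (rule cInf_superset_mono[OF lux_nonempty lux_bdd], safe)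
  fix l :: real assume l: "0 < l" "modular (q /\<^sub>R l) \<le> 1"
  have "modular_upto N (p /\<^sub>R l) \<le> modular_upto N (q /\<^sub>R l)" for N
    using assms l(1) by (intro modular_upto_mono) (auto simp: abs_mult mult_left_mono)
  with l(2) show "modular (p /\<^sub>R l) \<le> 1"
    unfolding modular_le_1_iff using order_trans by blast
qed

text \<open>The infimum in the Luxemburg norm is attained, as the modular is lower semicontinuous.\<close>

lemma lux_norm_le_iff:
  assumes "0 < l"
  shows "lux_norm p \<le> l \<longleftrightarrow> modular (p /\<^sub>R l) \<le> 1"
proof
  assume "modular (p /\<^sub>R l) \<le> 1"
  then show "lux_norm p \<le> l"
    unfolding lux_norm_def using assms by (intro cInf_lower lux_bdd) auto
next
  assume le: "lux_norm p \<le> l"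
  have above: "modular_upto N (p /\<^sub>R r) \<le> 1" if "l < r" for N r
  proof -
    have "lux_norm p < r" using le that by simp
    then obtain m where m: "0 < m" "modular (p /\<^sub>R m) \<le> 1" "m < r"
      unfolding lux_norm_def using cInf_lessD[OF lux_nonempty[of p]] by auto
    have "modular_upto N (p /\<^sub>R r) \<le> modular_upto N (p /\<^sub>R m)"
      using m by (intro modular_upto_mono) (auto simp: abs_mult intro!: mult_right_mono)
    with m(2) show ?thesis
      unfolding modular_le_1_iff by (meson order_trans)
  qed
  show "modular (p /\<^sub>R l) \<le> 1"
    unfolding modular_le_1_iff
  proof
    fix N
    have "((\<lambda>r. modular_upto N (p /\<^sub>R r)) \<longlongrightarrow> modular_upto N (p /\<^sub>R l)) (at_right l)"
      unfolding modular_upto_def fst_scaleR snd_scaleR scaleR_bcontfun.rep_eq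
      using assms by (intro tendsto_intros) auto
    moreover have "\<forall>\<^sub>F r in at_right l. modular_upto N (p /\<^sub>R r) \<le> 1"
      using above by (auto simp: eventually_at_filter)
    ultimately show "modular_upto N (p /\<^sub>R l) \<le> 1"
      by (rule tendsto_upperbound) simp
  qed
qed

lemma lux_norm_le_1_iff: "lux_norm p \<le> 1 \<longleftrightarrow> modular p \<le> 1"
  using lux_norm_le_iff[of 1 p] by simp


section \<open>Strict convexity\<close>

text \<open>Almost all terms are dominated by those of a geometric series, since almost all entries have
  absolute value below $1/2$. For bounded sequences the modular can be infinite.\<close>

lemma modular_finite_c0:
  assumes "apply_bcontfun (snd p) \<longlonglongrightarrow> 0"
  obtains C where "0 \<le> C" "modular p \<le> ennreal C"
proof -
  let ?t = "\<lambda>n. apply_bcontfun (snd p) n ^ (2 * (n + 1))"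
  obtain M where M: "\<And>n. n \<ge> M \<Longrightarrow> \<bar>apply_bcontfun (snd p) n\<bar> < 1/2"
    using LIMSEQ_D[OF assms, of "1/2"] by auto
  have "summable ?t"
  proof (rule summable_comparison_test')
    show "summable (\<lambda>n. (1/2 :: real) ^ n)" by (rule summable_geometric) simp
    fix n assume "n \<ge> M"
    from M[OF this] have "\<bar>apply_bcontfun (snd p) n\<bar> ^ (2 * (n + 1)) \<le> (1/2) ^ (2 * (n + 1))"
      by (intro power_mono) auto
    also have "\<dots> \<le> (1/2 :: real) ^ n" by (rule power_decreasing) auto
    finally show "norm (?t n) \<le> (1/2) ^ n" by (simp only: real_norm_def power_abs)
  qed
  then have "(\<Sum>n<N. ?t n) \<le> suminf ?t" for N
    by (intro sum_le_suminf even_power_nonneg) auto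
  then have "modular_upto N p \<le> norm (fst p) + suminf ?t" for N
    by (simp add: modular_upto_def)
  moreover from this[of 0] have "0 \<le> norm (fst p) + suminf ?t"
    using norm_ge_zero[of "fst p"] by (simp add: modular_upto_def)
  ultimately show thesis
    using that modular_le_iff by blast
qed

text \<open>The modular is finite at $2z$, and convexity between $z$ and $2z$ keeps it at most $1$ slightly
  beyond $z$.\<close>

lemma norm_less_1_if_modular_less_1:
  fixes z :: "'a::real_normed_vector zspace"
  assumes "0 < d" "d \<le> 1" "modular (zpair z) \<le> ennreal (1 - d)"
  shows "norm z < 1"
proof -
  have "apply_bcontfun (snd (2 *\<^sub>R zpair z)) \<longlonglongrightarrow> 0"
    using tendsto_mult_right_zero[of "apply_bcontfun (snd (zpair z))" sequentially 2] zpair[of z] by simp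
  then obtain C where C: "0 \<le> C" "modular (2 *\<^sub>R zpair z) \<le> ennreal C"
    by (rule modular_finite_c0)
  \<comment> \<open>small enough for $(1 - s)(1 - d) + s C \le 1$\<close>
  define s where "s = d / (C + 1)"
  have s: "0 < s" "s \<le> 1" "s * C \<le> d"
    using assms C by (auto simp: s_def field_simps)
  have eq: "(1 + s) *\<^sub>R zpair z = (1 - s) *\<^sub>R zpair z + s *\<^sub>R (2 *\<^sub>R zpair z)"
    by (simp flip: scaleR_add_left)
  have "modular ((1 + s) *\<^sub>R zpair z) \<le> ennreal (1 - s) * modular (zpair z) + ennreal s * modular (2 *\<^sub>R zpair z)"
    unfolding eq by (rule modular_convex) (use s in auto)
  also have "\<dots> \<le> ennreal (1 - s) * ennreal (1 - d) + ennreal s * ennreal C"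
    by (intro add_mono mult_left_mono assms C) auto
  also have "\<dots> = ennreal ((1 - s) * (1 - d) + s * C)"
    using s C assms by (simp add: ennreal_mult' ennreal_plus)
  also have "\<dots> \<le> 1"
  proof -
    have "(1 - s) * (1 - d) \<le> 1 - d" using s assms by (simp add: mult_left_le_one_le)
    with s have "(1 - s) * (1 - d) + s * C \<le> 1" by linarith
    then show ?thesis by simp
  qed
  finally have "lux_norm ((1 + s) *\<^sub>R zpair z) \<le> 1"
    by (simp add: lux_norm_le_1_iff)
  then have "(1 + s) * norm z \<le> 1"
    using s by (simp add: lux_norm_scaleR norm_zspace_def)
  moreover have "norm z < (1 + s) * norm z" if "norm z \<noteq> 0"
    using that s by (simp add: distrib_right)
  ultimately show ?thesis using order_less_le_trans zero_less_one by metis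
qed

lemma norm_midpoint_less_if_strictly_convex:
  fixes x y :: "'a::banach"
  assumes "strictly_convex TYPE('a)" "x \<noteq> y"
  shows "norm (x + y) / 2 < max (norm x) (norm y)"
proof -
  have "norm (x + y) \<le> norm x + norm y" by (rule norm_triangle_ineq)
  then consider "norm (x + y) / 2 < max (norm x) (norm y)" | "norm (x + y) / 2 = norm x" "norm x = norm y"
    by linarith
  then show ?thesis
    using assms unfolding strictly_convex_def by cases auto
qed

text \<open>After scaling, it is enough to bound the modular of the midpoint of two distinct points of the
  unit ball away from $1$. The gap $d$ comes from the first components if the sequences agree, and
  otherwise from a single entry $k$ in which they differ.\<close>

lemma strictly_convex_zspace:
  assumes "strictly_convex TYPE('a::banach)"
  shows "strictly_convex TYPE('a zspace)"
proof -
  have unit: "norm (u + v) / 2 < 1" if uv: "norm u \<le> 1" "norm v \<le> 1" "u \<noteq> v" for u v :: "'a zspace"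
  proof -
    define p q m where "p = zpair u" and "q = zpair v" and "m = zpair ((1/2) *\<^sub>R (u + v))"
    have fst_m: "norm (fst m) = norm (fst p + fst q) / 2"
      by (simp add: m_def p_def q_def plus_zspace.rep_eq scaleR_zspace.rep_eq flip: scaleR_add_right)
    have snd_m: "apply_bcontfun (snd m) n = (apply_bcontfun (snd p) n + apply_bcontfun (snd q) n) / 2" for n
      by (simp add: m_def p_def q_def plus_zspace.rep_eq scaleR_zspace.rep_eq)
    have "modular p \<le> 1" "modular q \<le> 1"
      using uv by (simp_all add: norm_zspace_def p_def q_def lux_norm_le_1_iff)
    then have pq: "modular_upto N p \<le> 1" "modular_upto N q \<le> 1" for N
      by (simp_all add: modular_le_1_iff)
    have "p \<noteq> q" using uv by (simp add: p_def q_def zpair_inject)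
    obtain d where d: "0 < d" "\<And>N. modular_upto N m \<le> 1 - d"
    proof (cases "snd p = snd q")
      case True
      then have "fst p \<noteq> fst q" using \<open>p \<noteq> q\<close> by (simp add: prod_eq_iff)
      then have lt: "norm (fst m) < max (norm (fst p)) (norm (fst q))"
        unfolding fst_m by (rule norm_midpoint_less_if_strictly_convex[OF assms])
      show thesis
      proof (rule that)
        show "0 < max (norm (fst p)) (norm (fst q)) - norm (fst m)" using lt by simp
        fix N show "modular_upto N m \<le> 1 - (max (norm (fst p)) (norm (fst q)) - norm (fst m))"
          using pq[of N] unfolding modular_upto_def snd_m True by (simp add: max_def)
      qed
    next
      case False
      then obtain k where k: "apply_bcontfun (snd p) k \<noteq> apply_bcontfun (snd q) k"
        by (metis bcontfun_eqI)
      let ?P = "\<lambda>n. apply_bcontfun (snd p) n ^ (2 * (n + 1))"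
        and ?Q = "\<lambda>n. apply_bcontfun (snd q) n ^ (2 * (n + 1))"
        and ?M = "\<lambda>n. apply_bcontfun (snd m) n ^ (2 * (n + 1))"
      define d where "d = (?P k + ?Q k) / 2 - ?M k"
      have "0 < d"
        unfolding d_def snd_m using even_power_midpoint_less[OF k, of k] by linarith
      have *: "modular_upto N m \<le> 1 - d" if "k < N" for N
      proof -
        have "(\<Sum>n<N. ?M n) = (\<Sum>n\<in>{..<N} - {k}. ?M n) + ?M k"
          using that by (subst sum.remove[of _ k]) auto
        also have "\<dots> \<le> (\<Sum>n\<in>{..<N} - {k}. (?P n + ?Q n) / 2) + ?M k"
          unfolding snd_m by (intro add_right_mono sum_mono even_power_midpoint_le)
        also have "\<dots> = (\<Sum>n<N. (?P n + ?Q n) / 2) - d"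
          using that by (subst (2) sum.remove[of _ k]) (auto simp: d_def)
        also have "\<dots> = ((\<Sum>n<N. ?P n) + (\<Sum>n<N. ?Q n)) / 2 - d"
          by (simp only: sum.distrib[symmetric] sum_divide_distrib[symmetric])
        finally have "modular_upto N m \<le> (modular_upto N p + modular_upto N q) / 2 - d"
          using norm_triangle_ineq[of "fst p" "fst q"] unfolding modular_upto_def fst_m by argo
        with pq[of N] show ?thesis by argo
      qed
      have "modular_upto N m \<le> 1 - d" for N
        using *[of "max N (Suc k)"] modular_upto_mono_N[of N "max N (Suc k)" m] by linarith
      with \<open>0 < d\<close> that show thesis by blast
    qed
    have "d \<le> 1"
      using order_trans[OF norm_ge_zero, of "fst m" "1 - d"] d(2)[of 0] by (simp add: modular_upto_def)
    then have "modular m \<le> ennreal (1 - d)"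
      using d by (simp add: modular_le_iff)
    with \<open>0 < d\<close> \<open>d \<le> 1\<close> have "norm ((1/2) *\<^sub>R (u + v)) < 1"
      unfolding m_def by (rule norm_less_1_if_modular_less_1)
    then show ?thesis by simp
  qed
  show ?thesis
    unfolding strictly_convex_def
  proof safe
    fix u v :: "'a zspace"
    assume mid: "norm (u + v) / 2 = norm u" and eq: "norm u = norm v"
    show "u = v"
    proof (rule ccontr)
      assume "u \<noteq> v"
      then have r: "norm u > 0" using eq by auto
      have "norm (u /\<^sub>R norm u + v /\<^sub>R norm u) / 2 < 1"
        using \<open>u \<noteq> v\<close> r eq by (intro unit) auto
      also have "u /\<^sub>R norm u + v /\<^sub>R norm u = (u + v) /\<^sub>R norm u"
        by (simp add: scaleR_add_right)
      also have "norm ((u + v) /\<^sub>R norm u) = norm (u + v) / norm u"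
        by (simp add: divide_inverse_commute)
      finally show False using mid r by (simp add: field_simps)
    qed
  qed
qed


section \<open>Almost squareness and slices\<close>

lemma norm_zunit [simp]: "norm (zunit n :: 'a::real_normed_vector zspace) = 1"
proof (rule antisym)
  have "modular_upto N (0 :: 'a, unit_seq n) \<le> 1" for N
  proof -
    have "modular_upto N (0 :: 'a, unit_seq n) = (\<Sum>k<N. if k = n then 1 else 0)"
      unfolding modular_upto_def by (intro trans[OF arg_cong2[of _ _ _ _ "(+)"] add_0] sum.cong)
        (auto simp: unit_seq.rep_eq)
    then show ?thesis by simp
  qed
  then show "norm (zunit n :: 'a zspace) \<le> 1"
    by (simp add: norm_zspace_def zunit.rep_eq lux_norm_le_1_iff modular_le_1_iff)
  have "1 = norm (apply_bcontfun (unit_seq n) n)"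
    by (simp add: unit_seq.rep_eq)
  also have "\<dots> \<le> norm (unit_seq n)"
    by (rule norm_bounded)
  also have "\<dots> \<le> norm (zunit n :: 'a zspace)"
    using norm_zspace_bounds(1)[of "zunit n :: 'a zspace"] by (simp add: max_norm_def zunit.rep_eq)
  finally show "1 \<le> norm (zunit n :: 'a zspace)" .
qed

text \<open>With $l = 1 + \varepsilon$, dividing by $l$ shrinks the modular by the factor $1/l$ at least. The
  entry that carries the additional $1$ contributes at most $q^n$, where $q < 1$, as soon as the
  original entry is at most $\varepsilon/2$.\<close>

lemma eventually_norm_add_zunit_le:
  fixes z :: "'a::real_normed_vector zspace"
  assumes "norm z \<le> 1" "0 < \<epsilon>"
  shows "\<forall>\<^sub>F n in sequentially. norm (z + zunit n) \<le> 1 + \<epsilon>"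
proof -
  define l q where "l = 1 + \<epsilon>" and "q = (1 + \<epsilon> / 2) / l"
  have l: "1 < l" and q: "0 < q" "q < 1"
    using assms by (auto simp: l_def q_def)
  let ?y = "apply_bcontfun (snd (zpair z))"
  have "?y \<longlonglongrightarrow> 0" using zpair[of z] by simp
  then have small: "\<forall>\<^sub>F n in sequentially. \<bar>?y n\<bar> < \<epsilon> / 2"
    using assms by (auto dest!: tendstoD[where e = "\<epsilon> / 2"])
  have "(\<lambda>n. q ^ n) \<longlonglongrightarrow> 0"
    using q by (intro LIMSEQ_power_zero) auto
  moreover have "0 < 1 - 1 / l" using l by simp
  ultimately have "\<forall>\<^sub>F n in sequentially. q ^ n < 1 - 1 / l"
    by (rule order_tendstoD)
  with small show ?thesis
  proof eventually_elim
    fix n assume y: "\<bar>?y n\<bar> < \<epsilon> / 2" and qn: "q ^ n < 1 - 1 / l"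
    have "modular_upto N (zpair (z + zunit n) /\<^sub>R l) \<le> 1" for N
    proof -
      have term_le: "((?y k + (if k = n then 1 else 0)) / l) ^ (2 * (k + 1))
          \<le> ?y k ^ (2 * (k + 1)) / l + (if k = n then q ^ n else 0)" for k
      proof (cases "k = n")
        case True
        have "((?y k + 1) / l) ^ (2 * (k + 1)) \<le> q ^ (2 * (k + 1))"
          using y l True q by (intro even_power_mono_abs) (auto simp: q_def intro!: divide_right_mono)
        also have "\<dots> \<le> q ^ n"
          using q True by (intro power_decreasing) auto
        finally show ?thesis
          using True l even_power_nonneg[of "?y k" k] by (simp add: add_increasing)
      next
        case False
        have "l \<le> l ^ (2 * (k + 1))"
          using l power_increasing[of 1 "2 * (k + 1)" l] by simp
        then have "?y k ^ (2 * (k + 1)) / l ^ (2 * (k + 1)) \<le> ?y k ^ (2 * (k + 1)) / l"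
          using l by (intro divide_left_mono even_power_nonneg) auto
        then show ?thesis using False by (simp add: power_divide del: power_Suc mult_Suc_right)
      qed
      have "modular_upto N (zpair (z + zunit n) /\<^sub>R l)
          = norm (fst (zpair z)) / l + (\<Sum>k<N. ((?y k + (if k = n then 1 else 0)) / l) ^ (2 * (k + 1)))"
        using l unfolding modular_upto_def
        by (simp add: plus_zspace.rep_eq zunit.rep_eq unit_seq.rep_eq divide_inverse mult.commute)
      also have "\<dots> \<le> norm (fst (zpair z)) / l + (\<Sum>k<N. ?y k ^ (2 * (k + 1)) / l + (if k = n then q ^ n else 0))"
        by (intro add_left_mono sum_mono term_le)
      also have "\<dots> = modular_upto N (zpair z) / l + (\<Sum>k<N. if k = n then q ^ n else 0)"
        by (simp only: modular_upto_def sum.distrib sum_divide_distrib add_divide_distrib add.assoc)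
      also have "\<dots> \<le> 1 / l + q ^ n"
      proof (rule add_mono)
        have "modular_upto N (zpair z) \<le> 1"
          using assms by (simp add: norm_zspace_def lux_norm_le_1_iff modular_le_1_iff)
        then show "modular_upto N (zpair z) / l \<le> 1 / l"
          using l by (intro divide_right_mono) auto
        show "(\<Sum>k<N. if k = n then q ^ n else 0) \<le> q ^ n"
          using q by simp
      qed
      finally show ?thesis using qn by simp
    qed
    then show "norm (z + zunit n) \<le> 1 + \<epsilon>"
      using l by (simp add: norm_zspace_def lux_norm_le_iff modular_le_1_iff flip: l_def)
  qed
qed

lemma almost_square_zspace: "almost_square TYPE('a::banach zspace)"
  unfolding almost_square_def
proof (intro allI impI)
  fix A :: "'a zspace set" and \<epsilon> :: real
  assume "0 < \<epsilon>" and A: "finite A \<and> A \<subseteq> sphere 0 1"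
  then have "\<forall>\<^sub>F n in sequentially. \<forall>z\<in>A. norm (z + zunit n) \<le> 1 + \<epsilon>"
    by (intro eventually_ball_finite ballI eventually_norm_add_zunit_le) (auto simp: subset_eq)
  then obtain n where "\<forall>z\<in>A. norm (z + zunit n) \<le> 1 + \<epsilon>"
    using eventually_happens'[OF sequentially_bot] by blast
  then show "\<exists>y\<in>sphere 0 1. \<forall>z\<in>A. norm (z + y) \<le> 1 + \<epsilon>"
    by (intro bexI[of _ "zunit n"]) auto
qed

lemma norm_blinfun_le_if_bound_on_ball:
  fixes f :: "'a::real_normed_vector dual"
  assumes "0 \<le> r" and bound: "\<And>x. norm x \<le> r \<Longrightarrow> blinfun_apply f x \<le> c"
  shows "r * norm f \<le> c"
proof (cases "r = 0")
  case True
  then show ?thesis using bound[of 0] by simp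
next
  case False
  then have r: "0 < r" using assms by simp
  have c: "0 \<le> c" using bound[of 0] r by simp
  have "norm f \<le> c / r"
  proof (rule norm_blinfun_bound)
    show "0 \<le> c / r" using r c by simp
    fix x
    show "norm (blinfun_apply f x) \<le> c / r * norm x"
    proof (cases "x = 0")
      case False
      then have "blinfun_apply f ((r / norm x) *\<^sub>R x) \<le> c" "blinfun_apply f (- (r / norm x) *\<^sub>R x) \<le> c"
        using r by (auto intro!: bound)
      then have "\<bar>r / norm x * blinfun_apply f x\<bar> \<le> c"
        by (simp add: blinfun.scaleR_right blinfun.minus_right abs_le_iff)
      then show ?thesis
        using r False by (simp add: abs_mult field_simps)
    qed simp
  qed
  then show ?thesis using r by (simp add: field_simps)
qed

lemma blinfun_almost_norming:
  fixes f :: "'a::real_normed_vector dual"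
  assumes "c < norm f"
  obtains x where "norm x \<le> 1" "c < blinfun_apply f x"
  using norm_blinfun_le_if_bound_on_ball[of 1 f c] assms by force

text \<open>Almost squareness is applied to a pair $x$, $-x$ with $f(x)$ close to $1$. Then
  $f(x) \pm f(y) \le 1 + d$ makes $f(y)$ small, and both $x \pm y$ stay in the slice after scaling.\<close>

lemma local_diameter_two_if_almost_square:
  assumes "almost_square TYPE('a::banach)"
  shows "local_diameter_two TYPE('a)"
  unfolding local_diameter_two_def
proof (intro allI impI)
  fix f :: "'a dual" and \<epsilon> :: real
  assume *: "norm f = 1 \<and> \<epsilon> > 0"
  let ?S = "slice f \<epsilon>"
  have bounded: "bounded ?S"
    by (rule bounded_subset[OF bounded_cball[of 0 1]]) (auto simp: slice_def)
  have "diameter ?S \<le> 2"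
  proof (rule diameter_le)
    fix x y assume "x \<in> ?S" "y \<in> ?S"
    then show "norm (x - y) \<le> 2"
      using norm_triangle_ineq4[of x y] by (auto simp: slice_def)
  qed simp
  moreover have "2 \<le> diameter ?S"
  proof (rule field_le_epsilon)
    fix e :: real assume "0 < e"
    \<comment> \<open>For scaled $x \pm y$ to lie in the slice, $1 - 3d > (1 - \varepsilon)(1 + d)$ is needed; $4d \le \varepsilon$ suffices.\<close>
    define d where "d = min (min (\<epsilon> / 4) (e / 2)) (1 / 4)"
    have d: "0 < d" "4 * d \<le> \<epsilon>" "2 * d \<le> e" "d < 1"
      using * \<open>0 < e\<close> by (auto simp: d_def)
    obtain x0 where x0: "norm x0 \<le> 1" "1 - d < blinfun_apply f x0"
      using blinfun_almost_norming[of "1 - d" f] * d by auto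
    have "x0 \<noteq> 0" using x0 d by auto
    define x where "x = x0 /\<^sub>R norm x0"
    have x: "norm x = 1" using \<open>x0 \<noteq> 0\<close> by (simp add: x_def)
    have "blinfun_apply f x0 \<le> blinfun_apply f x0 / norm x0"
      using x0 d \<open>x0 \<noteq> 0\<close> by (simp add: le_divide_eq mult_left_le)
    then have fx: "1 - d < blinfun_apply f x"
      using x0 by (simp add: x_def blinfun.scaleR_right field_simps)
    obtain y where y: "norm y = 1" "norm (x + y) \<le> 1 + d" "norm (- x + y) \<le> 1 + d"
      using assms[unfolded almost_square_def, rule_format, of d "{x, - x}"] x d by auto
    have le: "blinfun_apply f u \<le> 1 + d" if "norm u \<le> 1 + d" for u
      using norm_blinfun[of f u] * that by simp
    have fy: "\<bar>blinfun_apply f y\<bar> \<le> 2 * d"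
      using le[OF y(2)] le[of "x - y"] y(3) fx norm_minus_commute[of x y]
      by (simp add: blinfun.add_right blinfun.diff_right abs_le_iff)
    have mem: "u /\<^sub>R (1 + d) \<in> ?S" if "norm u \<le> 1 + d" "1 - 3 * d < blinfun_apply f u" for u
    proof -
      have "(1 - \<epsilon>) * (1 + d) < 1 - 3 * d"
      proof -
        have "(1 - \<epsilon>) * (1 + d) \<le> (1 - 4 * d) * (1 + d)"
          using d by (intro mult_right_mono) auto
        also have "\<dots> < 1 - 3 * d" using d by (simp add: algebra_simps)
        finally show ?thesis .
      qed
      with that d show ?thesis
        by (simp add: slice_def blinfun.scaleR_right field_simps)
    qed
    have "(x + y) /\<^sub>R (1 + d) \<in> ?S" "(x - y) /\<^sub>R (1 + d) \<in> ?S"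
      using y fx fy norm_minus_commute[of x y]
      by (auto intro!: mem simp: blinfun.add_right blinfun.diff_right abs_le_iff)
    then have "dist ((x + y) /\<^sub>R (1 + d)) ((x - y) /\<^sub>R (1 + d)) \<le> diameter ?S"
      by (rule diameter_bounded_bound[OF bounded])
    also have "dist ((x + y) /\<^sub>R (1 + d)) ((x - y) /\<^sub>R (1 + d)) = norm ((2 / (1 + d)) *\<^sub>R y)"
      by (simp add: dist_norm divide_inverse_commute flip: scaleR_diff_right scaleR_2)
    also have "\<dots> = 2 / (1 + d)" using y d by simp
    finally have "2 / (1 + d) \<le> diameter ?S" .
    moreover have "2 \<le> 2 / (1 + d) + 2 * d"
      using d by (simp add: field_simps)
    ultimately show "2 \<le> diameter ?S + e" using d by linarith
  qed
  ultimately show "diameter ?S = 2" by simp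
qed


section \<open>Coordinates and the unconditional basis\<close>

lift_definition zfst :: "'a::real_normed_vector zspace \<Rightarrow>\<^sub>L 'a" is "\<lambda>z. fst (zpair z)"
  by (rule bounded_linear_compose[OF bounded_linear_fst bounded_linear_zpair])

lift_definition zcoord :: "nat \<Rightarrow> 'a::real_normed_vector zspace dual" is
  "\<lambda>n z. apply_bcontfun (snd (zpair z)) n"
proof (rule bounded_linear_intro[where K = 1])
  fix n and z w :: "'a zspace" and r :: real
  show "apply_bcontfun (snd (zpair (z + w))) n = apply_bcontfun (snd (zpair z)) n + apply_bcontfun (snd (zpair w)) n"
    by (simp add: plus_zspace.rep_eq)
  show "apply_bcontfun (snd (zpair (r *\<^sub>R z))) n = r *\<^sub>R apply_bcontfun (snd (zpair z)) n"
    by (simp add: scaleR_zspace.rep_eq)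
  show "norm (apply_bcontfun (snd (zpair z)) n) \<le> norm z * 1"
    using norm_bounded[of "snd (zpair z)" n] norm_zspace_bounds(1)[of z] by (simp add: max_norm_def)
qed

lemma zfst_zinl [simp]: "blinfun_apply zfst (zinl x) = x"
  and zfst_zunit [simp]: "blinfun_apply zfst (zunit n) = 0"
  and zcoord_zinl [simp]: "blinfun_apply (zcoord n) (zinl x) = 0"
  and zcoord_zunit [simp]: "blinfun_apply (zcoord n) (zunit k) = (if n = k then 1 else 0)"
  by (simp_all add: zfst.rep_eq zcoord.rep_eq zinl.rep_eq zunit.rep_eq unit_seq.rep_eq)

lemma zcoord_sum_zunit:
  assumes "finite G"
  shows "blinfun_apply (zcoord n) (\<Sum>k\<in>G. c k *\<^sub>R zunit k) = (if n \<in> G then c n else 0)"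
  using assms by (simp add: blinfun.sum_right blinfun.scaleR_right if_distrib cong: if_cong)

lemma zfst_sum_zunit: "blinfun_apply zfst (\<Sum>k\<in>G. c k *\<^sub>R zunit k) = 0"
  by (simp add: blinfun.sum_right blinfun.scaleR_right)

lemma zcoord_tendsto_0: "(\<lambda>n. blinfun_apply (zcoord n) z) \<longlonglongrightarrow> 0"
  using zpair[of z] by (simp add: zcoord.rep_eq)

lemma norm_zspace_mono:
  fixes u :: "'a::real_normed_vector zspace" and v :: "'b::real_normed_vector zspace"
  assumes "norm (blinfun_apply zfst u) \<le> norm (blinfun_apply zfst v)"
    and "\<And>n. \<bar>blinfun_apply (zcoord n) u\<bar> \<le> \<bar>blinfun_apply (zcoord n) v\<bar>"
  shows "norm u \<le> norm v"
  using assms unfolding norm_zspace_def zfst.rep_eq zcoord.rep_eq by (rule lux_norm_mono)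

lemma norm_zspace_le_if_coordinates_le:
  fixes z :: "'a::real_normed_vector zspace"
  assumes "norm (blinfun_apply zfst z) \<le> r" "\<And>n. \<bar>blinfun_apply (zcoord n) z\<bar> \<le> r"
  shows "norm z \<le> 2 * r"
proof -
  have "norm (snd (zpair z)) \<le> r"
    by (rule norm_bound) (use assms(2) in \<open>simp add: zcoord.rep_eq\<close>)
  with assms(1) show ?thesis
    using norm_zspace_bounds(2)[of z] by (simp add: max_norm_def zfst.rep_eq)
qed

text \<open>The tail of a null sequence is uniformly small, so the sums converge along all finite sets,
  although the series need not converge absolutely.\<close>

lemma has_sum_zunit:
  "((\<lambda>n. blinfun_apply (zcoord n) z *\<^sub>R zunit n) has_sum (z - zinl (blinfun_apply zfst z))) UNIV"
  unfolding has_sum_def tendsto_iff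
proof safe
  fix e :: real assume "0 < e"
  then obtain M where M: "\<And>n. n \<ge> M \<Longrightarrow> \<bar>blinfun_apply (zcoord n) z\<bar> < e / 4"
    using LIMSEQ_D[OF zcoord_tendsto_0, of "e / 4" z] by auto
  have "dist (\<Sum>n\<in>G. blinfun_apply (zcoord n) z *\<^sub>R zunit n) (z - zinl (blinfun_apply zfst z)) < e"
    if G: "finite G" "{..<M} \<subseteq> G" for G
  proof -
    let ?d = "(\<Sum>n\<in>G. blinfun_apply (zcoord n) z *\<^sub>R zunit n) - (z - zinl (blinfun_apply zfst z))"
    have "norm ?d \<le> 2 * (e / 4)"
    proof (rule norm_zspace_le_if_coordinates_le)
      show "norm (blinfun_apply zfst ?d) \<le> e / 4"
        using \<open>0 < e\<close> by (simp add: blinfun.diff_right zfst_sum_zunit)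
      fix n
      show "\<bar>blinfun_apply (zcoord n) ?d\<bar> \<le> e / 4"
        using G \<open>0 < e\<close> M[of n] by (force simp: blinfun.diff_right zcoord_sum_zunit)
    qed
    then show ?thesis using \<open>0 < e\<close> by (simp add: dist_norm)
  qed
  then show "\<forall>\<^sub>F G in finite_subsets_at_top UNIV.
      dist (\<Sum>n\<in>G. blinfun_apply (zcoord n) z *\<^sub>R zunit n) (z - zinl (blinfun_apply zfst z)) < e"
    unfolding eventually_finite_subsets_at_top by (intro exI[of _ "{..<M}"]) auto
qed

definition zbasis :: "('g \<Rightarrow> 'a::real_normed_vector) \<Rightarrow> 'g + nat \<Rightarrow> 'a zspace" where
  "zbasis e = case_sum (\<lambda>\<gamma>. zinl (e \<gamma>)) zunit"

lemma zbasis_simps [simp]: "zbasis e (Inl \<gamma>) = zinl (e \<gamma>)" "zbasis e (Inr n) = zunit n"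
  by (simp_all add: zbasis_def)

text \<open>Convergence of a basis expansion splits into convergence in the first component and the
  identification of the remaining coefficients as coordinates. Existence and uniqueness of
  expansions both follow from this.\<close>

lemma has_sum_zbasis_iff:
  fixes e :: "'g \<Rightarrow> 'a::banach"
  shows "((\<lambda>i. a i *\<^sub>R zbasis e i) has_sum z) UNIV \<longleftrightarrow>
    ((\<lambda>\<gamma>. a (Inl \<gamma>) *\<^sub>R e \<gamma>) has_sum blinfun_apply zfst z) UNIV \<and>
    (\<forall>n. a (Inr n) = blinfun_apply (zcoord n) z)"
proof safe
  assume sum: "((\<lambda>i. a i *\<^sub>R zbasis e i) has_sum z) UNIV"
  have "((\<lambda>i. a i *\<^sub>R blinfun_apply zfst (zbasis e i)) has_sum blinfun_apply zfst z) UNIV"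
    using has_sum_bounded_linear[OF blinfun.bounded_linear_right sum, of zfst]
    by (simp add: blinfun.scaleR_right)
  then have "((\<lambda>i. a i *\<^sub>R blinfun_apply zfst (zbasis e i)) has_sum blinfun_apply zfst z) (range Inl)"
    by (subst has_sum_cong_neutral[where S = UNIV and g = "\<lambda>i. a i *\<^sub>R blinfun_apply zfst (zbasis e i)", symmetric])
       (auto simp: zbasis_def split: sum.splits)
  then show "((\<lambda>\<gamma>. a (Inl \<gamma>) *\<^sub>R e \<gamma>) has_sum blinfun_apply zfst z) UNIV"
    by (simp add: has_sum_reindex o_def)
  fix n
  have "((\<lambda>i. a i * blinfun_apply (zcoord n) (zbasis e i)) has_sum blinfun_apply (zcoord n) z) UNIV"
    using has_sum_bounded_linear[OF blinfun.bounded_linear_right sum, of "zcoord n"]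
    by (simp add: blinfun.scaleR_right)
  then have "((\<lambda>i. a i * blinfun_apply (zcoord n) (zbasis e i)) has_sum blinfun_apply (zcoord n) z) {Inr n}"
    by (subst has_sum_cong_neutral[where S = UNIV and g = "\<lambda>i. a i * blinfun_apply (zcoord n) (zbasis e i)", symmetric])
       (auto simp: zbasis_def split: sum.splits)
  moreover have "((\<lambda>i. a i * blinfun_apply (zcoord n) (zbasis e i)) has_sum a (Inr n)) {Inr n}"
    by (rule has_sum_finiteI) auto
  ultimately show "a (Inr n) = blinfun_apply (zcoord n) z"
    using has_sum_unique by metis
next
  assume fst: "((\<lambda>\<gamma>. a (Inl \<gamma>) *\<^sub>R e \<gamma>) has_sum blinfun_apply zfst z) UNIV"
    and snd: "\<forall>n. a (Inr n) = blinfun_apply (zcoord n) z"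
  have "((\<lambda>i. a i *\<^sub>R zbasis e i) has_sum zinl (blinfun_apply zfst z)) (range Inl)"
    using has_sum_bounded_linear[OF bounded_linear_zinl fst]
    by (simp add: has_sum_reindex o_def linear_scale[OF bounded_linear.linear[OF bounded_linear_zinl]])
  moreover have "((\<lambda>i. a i *\<^sub>R zbasis e i) has_sum (z - zinl (blinfun_apply zfst z))) (range Inr)"
    using has_sum_zunit[of z] snd by (simp add: has_sum_reindex o_def)
  ultimately have "((\<lambda>i. a i *\<^sub>R zbasis e i) has_sum (zinl (blinfun_apply zfst z) + (z - zinl (blinfun_apply zfst z))))
      (range Inl \<union> range Inr)"
    by (rule has_sum_Un_disjoint) auto
  moreover have "range Inl \<union> range Inr = (UNIV :: ('g + nat) set)"
    by (metis UNIV_Plus_UNIV Plus_def)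
  ultimately show "((\<lambda>i. a i *\<^sub>R zbasis e i) has_sum z) UNIV" by simp
qed

lemma unconditional_basis_zbasis:
  fixes e :: "'g \<Rightarrow> 'a::banach"
  assumes "unconditional_basis e"
  shows "unconditional_basis (zbasis e)"
  unfolding unconditional_basis_def
proof
  fix z :: "'a zspace"
  obtain a where a: "((\<lambda>\<gamma>. a \<gamma> *\<^sub>R e \<gamma>) has_sum blinfun_apply zfst z) UNIV"
    and uniq: "\<And>b. ((\<lambda>\<gamma>. b \<gamma> *\<^sub>R e \<gamma>) has_sum blinfun_apply zfst z) UNIV \<Longrightarrow> b = a"
    using assms unfolding unconditional_basis_def by metis
  show "\<exists>!a. ((\<lambda>i. a i *\<^sub>R zbasis e i) has_sum z) UNIV"
    unfolding has_sum_zbasis_iff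
  proof (rule ex1I)
    show "((\<lambda>\<gamma>. case_sum a (\<lambda>n. blinfun_apply (zcoord n) z) (Inl \<gamma>) *\<^sub>R e \<gamma>) has_sum blinfun_apply zfst z) UNIV
        \<and> (\<forall>n. case_sum a (\<lambda>n. blinfun_apply (zcoord n) z) (Inr n) = blinfun_apply (zcoord n) z)"
      using a by simp
    fix b
    assume b: "((\<lambda>\<gamma>. b (Inl \<gamma>) *\<^sub>R e \<gamma>) has_sum blinfun_apply zfst z) UNIV
      \<and> (\<forall>n. b (Inr n) = blinfun_apply (zcoord n) z)"
    then have "(\<lambda>\<gamma>. b (Inl \<gamma>)) = a" by (intro uniq) auto
    then show "b = case_sum a (\<lambda>n. blinfun_apply (zcoord n) z)"
      using b by (auto simp: fun_eq_iff split: sum.split)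
  qed
qed

lemma one_unconditional_basis_zbasis:
  fixes e :: "'g \<Rightarrow> 'a::banach"
  assumes "one_unconditional_basis e"
  shows "one_unconditional_basis (zbasis e)"
  unfolding one_unconditional_basis_def
proof safe
  show "unconditional_basis (zbasis e)"
    using assms by (simp add: one_unconditional_basis_def unconditional_basis_zbasis)
  fix F :: "('g + nat) set" and a b :: "'g + nat \<Rightarrow> real"
  assume "finite F" and le: "\<forall>i\<in>F. \<bar>b i\<bar> \<le> \<bar>a i\<bar>"
  define A B where "A = Inl -` F" and "B = Inr -` F"
  have fin: "finite A" "finite B"
    using \<open>finite F\<close> by (auto simp: A_def B_def intro: finite_vimageI)
  have F: "F = A <+> B"
    unfolding A_def B_def by (auto simp: Plus_def image_iff) (metis sumE)
  have fst: "blinfun_apply zfst (\<Sum>i\<in>F. c i *\<^sub>R zbasis e i) = (\<Sum>\<gamma>\<in>A. c (Inl \<gamma>) *\<^sub>R e \<gamma>)" for c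
    unfolding F by (simp add: sum.Plus fin blinfun.sum_right blinfun.add_right blinfun.scaleR_right)
  have snd: "blinfun_apply (zcoord n) (\<Sum>i\<in>F. c i *\<^sub>R zbasis e i) = (if n \<in> B then c (Inr n) else 0)" for c n
    unfolding F by (simp add: sum.Plus fin blinfun.add_right zcoord_sum_zunit)
       (simp add: blinfun.sum_right blinfun.scaleR_right)
  show "norm (\<Sum>i\<in>F. b i *\<^sub>R zbasis e i) \<le> norm (\<Sum>i\<in>F. a i *\<^sub>R zbasis e i)"
  proof (rule norm_zspace_mono)
    show "norm (blinfun_apply zfst (\<Sum>i\<in>F. b i *\<^sub>R zbasis e i)) \<le> norm (blinfun_apply zfst (\<Sum>i\<in>F. a i *\<^sub>R zbasis e i))"
      unfolding fst using assms fin le by (auto simp: one_unconditional_basis_def A_def)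
    fix n
    show "\<bar>blinfun_apply (zcoord n) (\<Sum>i\<in>F. b i *\<^sub>R zbasis e i)\<bar> \<le> \<bar>blinfun_apply (zcoord n) (\<Sum>i\<in>F. a i *\<^sub>R zbasis e i)\<bar>"
      unfolding snd using le by (auto simp: B_def)
  qed
qed


section \<open>The bidual\<close>

lemma bidual_map_eq:
  "blinfun_apply (bidual_map p) f =
    blinfun_apply (fst p) (f o\<^sub>L Blinfun zinl) + (\<Sum>n. apply_bcontfun (snd p) n * blinfun_apply f (zunit n))"
  by (simp add: bidual_map.rep_eq)

lemma Blinfun_zinl_apply: "blinfun_apply (Blinfun zinl) x = zinl x"
  by (simp add: bounded_linear_Blinfun_apply[OF bounded_linear_zinl])

lemma linear_bidual_map: "linear (bidual_map :: 'a::real_normed_vector bidual \<times> linfty \<Rightarrow> _)"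
proof (rule linearI)
  fix p q :: "'a bidual \<times> linfty" and r :: real
  show "bidual_map (p + q) = bidual_map p + bidual_map q"
    by (rule blinfun_eqI)
       (simp add: bidual_map_eq blinfun.add_left distrib_right suminf_add summable_linfty_zunit')
  show "bidual_map (r *\<^sub>R p) = r *\<^sub>R bidual_map p"
    by (rule blinfun_eqI)
       (simp add: bidual_map_eq blinfun.scaleR_left distrib_left mult.assoc suminf_mult summable_linfty_zunit')
qed

text \<open>An element $F$ of a bidual satisfies $F(g) \le \|F\| \, \|g\|$, and the right side is the supremum
  of $g$ over the ball of radius $\|F\|$ of the space itself. So $F$ may be replaced by such points
  $x$, and $y$ by its truncations, without increasing the modular.\<close>

lemma bidual_map_le_norm:
  fixes p :: "'a::real_normed_vector bidual \<times> linfty"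
  assumes "modular p \<le> 1"
  shows "blinfun_apply (bidual_map p) f \<le> norm f"
proof -
  let ?g = "f o\<^sub>L Blinfun zinl" and ?y = "apply_bcontfun (snd p)"
  have fin: "blinfun_apply (fst p) ?g + (\<Sum>n<N. ?y n * blinfun_apply f (zunit n)) \<le> norm f" for N
  proof -
    have "norm (fst p) * norm ?g \<le> norm f - (\<Sum>n<N. ?y n * blinfun_apply f (zunit n))"
    proof (rule norm_blinfun_le_if_bound_on_ball)
      fix x :: 'a assume x: "norm x \<le> norm (fst p)"
      let ?z = "zinl x + (\<Sum>n<N. ?y n *\<^sub>R zunit n)"
      have "lux_norm (zpair ?z) \<le> lux_norm p"
        using x by (intro lux_norm_mono)
          (auto simp: plus_zspace.rep_eq zinl.rep_eq zpair_sum_zunit)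
      also have "\<dots> \<le> 1" using assms by (simp add: lux_norm_le_1_iff)
      finally have z: "norm ?z \<le> 1" by (simp add: norm_zspace_def)
      have "blinfun_apply f ?z \<le> norm f * norm ?z"
        using norm_blinfun[of f ?z] by simp
      also have "\<dots> \<le> norm f" using z by (simp add: mult_left_le)
      finally show "blinfun_apply ?g x \<le> norm f - (\<Sum>n<N. ?y n * blinfun_apply f (zunit n))"
        by (simp add: Blinfun_zinl_apply blinfun.add_right blinfun.sum_right blinfun.scaleR_right)
    qed simp
    moreover have "blinfun_apply (fst p) ?g \<le> norm (fst p) * norm ?g"
      using norm_blinfun[of "fst p" ?g] by simp
    ultimately show ?thesis by linarith
  qed
  have "(\<lambda>N. blinfun_apply (fst p) ?g + (\<Sum>n<N. ?y n * blinfun_apply f (zunit n))) \<longlonglongrightarrow> blinfun_apply (bidual_map p) f"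
    unfolding bidual_map_eq by (intro tendsto_intros summable_LIMSEQ summable_linfty_zunit')
  then show ?thesis
    by (rule LIMSEQ_le_const2) (use fin in auto)
qed

lemma norm_bidual_map_le_1:
  fixes p :: "'a::real_normed_vector bidual \<times> linfty"
  assumes "modular p \<le> 1"
  shows "norm (bidual_map p) \<le> 1"
proof (rule norm_blinfun_bound)
  fix f
  have "modular (- p) = modular p" by (simp add: modular_def)
  then have "blinfun_apply (bidual_map (- p)) f \<le> norm f"
    using assms by (intro bidual_map_le_norm) simp
  then show "norm (blinfun_apply (bidual_map p) f) \<le> 1 * norm f"
    using bidual_map_le_norm[OF assms, of f]
    by (simp add: linear_neg[OF linear_bidual_map] blinfun.minus_left abs_le_iff)
qed simp

text \<open>The functional $h$ is the linear part of an affine minorant of the modular that exceeds $1$ at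
  $p$. The minorant consists of a functional $g$ of norm at most $1$, under which \<open>fst p\<close> nearly
  attains its norm, and of the tangents of the even powers at the entries of $p$. Moving the
  constant terms of the tangents to the other side gives the bound $M$ for $h$ on the unit ball.\<close>

lemma norm_bidual_map_gt_1:
  fixes p :: "'a::real_normed_vector bidual \<times> linfty"
  assumes "\<not> modular p \<le> 1"
  shows "1 < norm (bidual_map p)"
proof -
  let ?y = "apply_bcontfun (snd p)"
  obtain N where "1 < norm (fst p) + (\<Sum>n<N. ?y n ^ (2 * (n + 1)))"
    using assms by (auto simp: modular_le_1_iff modular_upto_def not_le)
  then have "1 - (\<Sum>n<N. ?y n ^ (2 * (n + 1))) < norm (fst p)" by simp
  then obtain g where g: "norm g \<le> 1" "1 - (\<Sum>n<N. ?y n ^ (2 * (n + 1))) < blinfun_apply (fst p) g"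
    by (rule blinfun_almost_norming)
  define c where "c n = real (2 * (n + 1)) * ?y n ^ (2 * n + 1)" for n
  define h where "h = (g o\<^sub>L zfst) + (\<Sum>n<N. c n *\<^sub>R zcoord n)"
  define M where "M = 1 + (\<Sum>n<N. c n * ?y n - ?y n ^ (2 * (n + 1)))"
  have h: "blinfun_apply h z = blinfun_apply g (blinfun_apply zfst z) + (\<Sum>n<N. c n * blinfun_apply (zcoord n) z)" for z
    by (simp add: h_def blinfun.add_left blinfun.sum_left blinfun.scaleR_left)
  have "1 * norm h \<le> M"
  proof (rule norm_blinfun_le_if_bound_on_ball)
    fix z :: "'a zspace" assume "norm z \<le> 1"
    then have le: "modular_upto N (zpair z) \<le> 1"
      by (simp add: norm_zspace_def lux_norm_le_1_iff modular_le_1_iff)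
    have "blinfun_apply g (blinfun_apply zfst z) \<le> norm g * norm (blinfun_apply zfst z)"
      using norm_blinfun[of g "blinfun_apply zfst z"] by simp
    also have "\<dots> \<le> norm (blinfun_apply zfst z)"
      using g by (simp add: mult_left_le_one_le)
    finally have "blinfun_apply h z \<le> norm (blinfun_apply zfst z)
        + (\<Sum>n<N. blinfun_apply (zcoord n) z ^ (2 * (n + 1)) + (c n * ?y n - ?y n ^ (2 * (n + 1))))"
      unfolding h
    proof (rule add_mono, intro sum_mono)
      fix n
      show "c n * blinfun_apply (zcoord n) z
          \<le> blinfun_apply (zcoord n) z ^ (2 * (n + 1)) + (c n * ?y n - ?y n ^ (2 * (n + 1)))"
        using even_power_above_tangent_le[of "?y n" n "blinfun_apply (zcoord n) z"]
        unfolding c_def[symmetric] right_diff_distrib by linarith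
    qed
    also have "\<dots> = modular_upto N (zpair z) + (M - 1)"
      by (simp only: M_def modular_upto_def zfst.rep_eq zcoord.rep_eq sum.distrib)
    finally show "blinfun_apply h z \<le> M" using le by simp
  qed simp
  then have hM: "norm h \<le> M" by simp
  have "(\<Sum>n. ?y n * blinfun_apply h (zunit n)) = (\<Sum>n<N. ?y n * blinfun_apply h (zunit n))"
    by (rule suminf_finite) (auto simp: h)
  also have "\<dots> = (\<Sum>n<N. c n * ?y n)"
    by (intro sum.cong) (auto simp: h if_distrib mult.commute cong: if_cong)
  finally have sum: "(\<Sum>n. ?y n * blinfun_apply h (zunit n)) = (\<Sum>n<N. c n * ?y n)" .
  have "h o\<^sub>L Blinfun zinl = g"
    by (rule blinfun_eqI) (simp add: h Blinfun_zinl_apply)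
  then have "blinfun_apply (bidual_map p) h = blinfun_apply (fst p) g + (\<Sum>n<N. c n * ?y n)"
    by (simp add: bidual_map_eq sum)
  then have "M < blinfun_apply (bidual_map p) h"
    using g unfolding M_def sum_subtractf by linarith
  also have "\<dots> \<le> norm (bidual_map p) * norm h"
    using norm_blinfun[of "bidual_map p" h] by simp
  finally have *: "norm h < norm (bidual_map p) * norm h" using hM by simp
  then have "0 < norm h" by (cases "h = 0") auto
  with * show ?thesis by simp
qed

lemma norm_bidual_map:
  fixes p :: "'a::real_normed_vector bidual \<times> linfty"
  shows "norm (bidual_map p) = lux_norm p"
proof -
  have scale: "norm (bidual_map (p /\<^sub>R l)) = norm (bidual_map p) / l" if "0 < l" for l
    using that by (simp add: linear_scale[OF linear_bidual_map] divide_inverse_commute)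
  have iff: "norm (bidual_map p) \<le> l \<longleftrightarrow> lux_norm p \<le> l" if "0 < l" for l
    using scale[OF that] norm_bidual_map_le_1[of "p /\<^sub>R l"] norm_bidual_map_gt_1[of "p /\<^sub>R l"] that
    by (cases "modular (p /\<^sub>R l) \<le> 1") (auto simp: lux_norm_le_iff divide_le_eq less_divide_eq)
  have "0 \<le> lux_norm p"
    using max_norm_nonneg[of p] max_norm_le_lux_norm[of p] by linarith
  show ?thesis
  proof (rule antisym; rule field_le_epsilon)
    fix e :: real assume "0 < e"
    then show "norm (bidual_map p) \<le> lux_norm p + e"
      using iff[of "lux_norm p + e"] \<open>0 \<le> lux_norm p\<close> by simp
    show "lux_norm p \<le> norm (bidual_map p) + e"
      using iff[of "norm (bidual_map p) + e"] \<open>0 < e\<close> by (simp add: add_nonneg_pos)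
  qed
qed

lemma norm_zcoord_le: "norm (zcoord n :: 'a::real_normed_vector zspace dual) \<le> 1"
proof (rule norm_blinfun_bound)
  fix z :: "'a zspace"
  show "norm (blinfun_apply (zcoord n) z) \<le> 1 * norm z"
    using norm_bounded[of "snd (zpair z)" n] norm_zspace_bounds(1)[of z]
    by (simp add: zcoord.rep_eq max_norm_def)
qed simp

text \<open>The values on the unit vectors are absolutely summable, so the series converges in the norm of
  the dual, and its sum may be computed pointwise.\<close>

lemma zspace_dual_sums:
  fixes f :: "'a::real_normed_vector zspace dual"
  shows "(\<lambda>n. blinfun_apply f (zunit n) *\<^sub>R zcoord n) sums (f - ((f o\<^sub>L Blinfun zinl) o\<^sub>L zfst))"
proof -
  let ?t = "\<lambda>n. blinfun_apply f (zunit n) *\<^sub>R (zcoord n :: 'a zspace dual)"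
  have "summable ?t"
  proof (rule summable_comparison_test'[OF summable_zunit(1)])
    fix n show "norm (?t n) \<le> \<bar>blinfun_apply f (zunit n)\<bar>"
      using norm_zcoord_le[where 'a = 'a] by (simp add: mult_left_le)
  qed
  moreover have "suminf ?t = f - ((f o\<^sub>L Blinfun zinl) o\<^sub>L zfst)"
  proof (rule blinfun_eqI)
    fix z :: "'a zspace"
    have "blinfun_apply (suminf ?t) z = (\<Sum>n. blinfun_apply (?t n) z)"
      by (rule bounded_linear.suminf[OF blinfun.bounded_linear_left \<open>summable ?t\<close>])
    also have "\<dots> = (\<Sum>n. apply_bcontfun (snd (zpair z)) n * blinfun_apply f (zunit n))"
      by (simp add: blinfun.scaleR_left zcoord.rep_eq mult.commute)
    also have "\<dots> = blinfun_apply f z - blinfun_apply f (zinl (fst (zpair z)))"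
      using arg_cong[OF bidual_map_canonical_embedding[of z], of "\<lambda>F. blinfun_apply F f"]
      by (simp add: bidual_map_eq canonical_embedding.rep_eq Blinfun_zinl_apply)
    finally show "blinfun_apply (suminf ?t) z = blinfun_apply (f - ((f o\<^sub>L Blinfun zinl) o\<^sub>L zfst)) z"
      by (simp add: blinfun.diff_left Blinfun_zinl_apply zfst.rep_eq)
  qed
  ultimately show ?thesis by (simp add: sums_iff)
qed

text \<open>The preimage of $F$ is read off from its values on the functionals that depend on the first
  component alone and on the coordinate functionals. These span a dense subspace of the dual.\<close>

lemma surj_bidual_map: "surj (bidual_map :: 'a::real_normed_vector bidual \<times> linfty \<Rightarrow> _)"
  unfolding surj_def
proof
  fix F :: "'a zspace bidual"
  have bl: "bounded_linear (\<lambda>g. blinfun_apply F (g o\<^sub>L zfst))"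
    by (rule bounded_linear_compose[OF blinfun.bounded_linear_right])
       (rule bounded_bilinear.bounded_linear_left[OF bounded_bilinear_blinfun_compose])
  have "norm (blinfun_apply F (zcoord n)) \<le> norm F" for n
    using norm_blinfun[of F "zcoord n"] norm_zcoord_le[where 'a = 'a and n = n]
    by (meson mult_left_le norm_ge_zero order_trans)
  then have "(\<lambda>n. blinfun_apply F (zcoord n)) \<in> bcontfun"
    by (intro bcontfun_normI) auto
  then have y: "apply_bcontfun (Bcontfun (\<lambda>n. blinfun_apply F (zcoord n))) n = blinfun_apply F (zcoord n)" for n
    by (simp add: Bcontfun_inverse)
  define p where "p = (Blinfun (\<lambda>g. blinfun_apply F (g o\<^sub>L zfst)), Bcontfun (\<lambda>n. blinfun_apply F (zcoord n)))"
  have "bidual_map p = F"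
  proof (rule blinfun_eqI)
    fix f :: "'a zspace dual"
    have "(\<lambda>n. blinfun_apply F (blinfun_apply f (zunit n) *\<^sub>R zcoord n))
        sums blinfun_apply F (f - ((f o\<^sub>L Blinfun zinl) o\<^sub>L zfst))"
      by (rule bounded_linear.sums[OF blinfun.bounded_linear_right zspace_dual_sums])
    then have "(\<Sum>n. blinfun_apply F (zcoord n) * blinfun_apply f (zunit n))
        = blinfun_apply F f - blinfun_apply F ((f o\<^sub>L Blinfun zinl) o\<^sub>L zfst)"
      by (simp add: blinfun.scaleR_right blinfun.diff_right sums_iff mult.commute)
    then show "blinfun_apply (bidual_map p) f = blinfun_apply F f"
      by (simp add: bidual_map_eq p_def y bounded_linear_Blinfun_apply[OF bl])
  qed
  then show "\<exists>p. F = bidual_map p" by blast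
qed

lemma bij_bidual_map: "bij (bidual_map :: 'a::real_normed_vector bidual \<times> linfty \<Rightarrow> _)"
proof (rule bijI[OF _ surj_bidual_map])
  show "inj (bidual_map :: 'a bidual \<times> linfty \<Rightarrow> _)"
    unfolding linear_injective_0[OF linear_bidual_map]
    using norm_bidual_map lux_norm_eq_0 by (metis norm_zero)
qed

theorem theorem5p3:
  fixes e :: "'g \<Rightarrow> 'a::banach"
  assumes "strictly_convex TYPE('a)"
  shows "strictly_convex TYPE('a zspace) \<and>
    almost_square TYPE('a zspace) \<and>
    local_diameter_two TYPE('a zspace) \<and>
    (one_unconditional_basis e \<and> shrinking e \<longrightarrow>
      (\<exists>b :: 'g + nat \<Rightarrow> 'a zspace. one_unconditional_basis b) \<and>
      (linear (bidual_map :: 'a bidual \<times> linfty \<Rightarrow> 'a zspace bidual) \<and>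
       bij (bidual_map :: 'a bidual \<times> linfty \<Rightarrow> 'a zspace bidual) \<and>
       (\<forall>p :: 'a bidual \<times> linfty. norm (bidual_map p) = lux_norm p)))"
proof (intro conjI impI allI)
  show "strictly_convex TYPE('a zspace)"
    by (rule strictly_convex_zspace[OF assms])
  show "almost_square TYPE('a zspace)"
    by (rule almost_square_zspace)
  then show "local_diameter_two TYPE('a zspace)"
    by (rule local_diameter_two_if_almost_square)
  show "\<exists>b :: 'g + nat \<Rightarrow> 'a zspace. one_unconditional_basis b"
    if "one_unconditional_basis e \<and> shrinking e"
    using that one_unconditional_basis_zbasis by blast
  show "linear (bidual_map :: 'a bidual \<times> linfty \<Rightarrow> 'a zspace bidual)"
    by (rule linear_bidual_map)
  show "bij (bidual_map :: 'a bidual \<times> linfty \<Rightarrow> 'a zspace bidual)"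
    by (rule bij_bidual_map)
  show "norm (bidual_map p) = lux_norm p" for p :: "'a bidual \<times> linfty"
    by (rule norm_bidual_map)
qed

end
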